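(* Let $q$ be a prime power, let $V$ be a finite-dimensional vector space over $\mathbb F_q$ with $\dim V=R$, let $W\subsetneq V$ be a proper subspace, let $Y\le V$ be a subspace and let $X$ be a hyperplane of $Y$ (a subspace of $Y$ with $\dim X=\dim Y-1$). Let $$S\subseteq(\mathbb P(Y)\setminus\mathbb P(X))\setminus\mathbb P(W)$$ be any subset such that $M=(\mathbb P(V)\setminus\mathbb P(W))\setminus S$ spans $V$. Put $B=\mathbb P(V)\setminus\mathbb P(W)$ and $\ell=\dim(W\cap X)$. Then $$\deg(Q_M-Q_B)\le\min\{\ell+1,\lfloor (R-1)/2\rfloor\}.$$ Moreover, the bound $\ell+1$ is sharp for every $\ell\ge0$ and every finite field: for every prime power $q$ and every integer $\ell\ge 0$ there exist a finite-dimensional vector space $V$ over $\mathbb F_q$, a proper subspace $W\subsetneq V$, a subspace $Y\le V$, a hyperplane $X$ of $Y$, and a subset $S\subseteq(\mathbb P(Y)\setminus\mathbb P(X))\setminus\mathbb P(W)$ such that $M=(\mathbb P(V)\setminus\mathbb P(W))\setminus S$ spans $V$ and, with $B=\mathbb P(V)\setminus\mathbb P(W)$, one has $\dim(W\cap X)=\ell$ and $\deg(Q_M-Q_B)=\ell+1$.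
   Context: For a vector space $V$ over $\mathbb F_q$, $\mathbb P(V)$ denotes the set of its projective points (one-dimensional subspaces). A subset $E\subseteq\mathbb P(V)$ is identified with the simple matroid on ground set $E$ represented by it: the rank of a subset is the dimension of its linear span. $E$ spans $V$ if this span is $V$. The zero polynomial has degree $-\infty$. Matroid polynomials: for a loopless matroid $M$ of rank $r$, let $L(M)$ be its lattice of flats, $M|F$ the restriction to a flat $F$, $M/F$ the contraction, $\mu$ the Möbius function of $L(M)$, and $\chi_M(t)=\sum_{F\in L(M)}\mu(\varnothing,F)t^{r-\operatorname{rk}F}$. The Kazhdan–Lusztig polynomial $P_M$ is determined by: $P_M=1$ if $r=0$; $\deg P_M<r/2$ if $r>0$; and $t^rP_M(t^{-1})=\sum_{F\in L(M)}\chi_{M|F}(t)P_{M/F}(t)$. The (ordinary, unnormalized) inverse Kazhdan–Lusztig polynomial $Q_M$ is determined by $Q_M=1$ if $r=0$, and for $r>0$, $$Q_M=\sum_{\varnothing\ne F\in L(M)}(-1)^{\operatorname{rk}F+1}P_{M|F}\,Q_{M/F}.$$ *)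

theory Defs
  imports
    "HOL-Computational_Algebra.Polynomial"
    "HOL-Library.Function_Algebras"
begin

section \<open>Matroids\<close>

text \<open>
  A matroid is given by its ground set and its rank function. Only the values of the rank
  function on subsets of the ground set are meaningful.
\<close>

record 'a matroid =
  ground :: "'a set"
  rk :: "'a set \<Rightarrow> nat"

definition is_matroid :: "'a matroid \<Rightarrow> bool" where
  "is_matroid M \<longleftrightarrow>
     finite (ground M) \<and>
     (\<forall>A. A \<subseteq> ground M \<longrightarrow> rk M A \<le> card A) \<and>
     (\<forall>A B. A \<subseteq> B \<longrightarrow> B \<subseteq> ground M \<longrightarrow> rk M A \<le> rk M B) \<and>
     (\<forall>A B. A \<subseteq> ground M \<longrightarrow> B \<subseteq> ground M \<longrightarrow>
        rk M (A \<union> B) + rk M (A \<inter> B) \<le> rk M A + rk M B)"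

definition loopless :: "'a matroid \<Rightarrow> bool" where
  "loopless M \<longleftrightarrow> (\<forall>e\<in>ground M. rk M {e} \<noteq> 0)"

abbreviation mrank :: "'a matroid \<Rightarrow> nat" where
  "mrank M \<equiv> rk M (ground M)"

definition flats :: "'a matroid \<Rightarrow> 'a set set" where
  "flats M = {F. F \<subseteq> ground M \<and> (\<forall>e\<in>ground M - F. rk M F < rk M (insert e F))}"

definition mrestrict :: "'a matroid \<Rightarrow> 'a set \<Rightarrow> 'a matroid" where
  "mrestrict M F = \<lparr>ground = F, rk = rk M\<rparr>"

definition mcontract :: "'a matroid \<Rightarrow> 'a set \<Rightarrow> 'a matroid" where
  "mcontract M F = \<lparr>ground = ground M - F, rk = (\<lambda>A. rk M (A \<union> F) - rk M F)\<rparr>"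


section \<open>Matroid polynomials\<close>

text \<open>
  The Moebius function of a family of finite sets ordered by inclusion. The value is 0 on pairs
  that are not comparable; the guard \<open>finite B\<close> only serves termination.
\<close>

function moebius :: "'a set set \<Rightarrow> 'a set \<Rightarrow> 'a set \<Rightarrow> int" where
  "moebius L A B =
     (if A = B then 1
      else if finite B \<and> A \<subset> B then - (\<Sum>C\<in>{C\<in>L. A \<subseteq> C \<and> C \<subset> B}. moebius L A C)
      else 0)"
  by auto
termination
  by (relation "measure (\<lambda>(L, A, B). card B)") (auto intro: psubset_card_mono)

declare moebius.simps [simp del]

definition charpoly :: "'a matroid \<Rightarrow> int poly" where
  "charpoly M = (\<Sum>F\<in>flats M. monom (moebius (flats M) {} F) (mrank M - rk M F))"

text \<open>
  For a polynomial p of degree at most r, this is the polynomial \<open>t^r p(1/t)\<close>; recall that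
  \<open>reflect_poly p\<close> is \<open>t^(degree p) p(1/t)\<close>.
\<close>

definition reverse_at :: "nat \<Rightarrow> int poly \<Rightarrow> int poly" where
  "reverse_at r p = monom 1 (r - degree p) * reflect_poly p"

text \<open>
  The conditions determining the Kazhdan-Lusztig polynomials of all loopless matroids
  simultaneously. The term for \<open>F = {}\<close> on the right-hand side is \<open>P M\<close> itself. The convention
  \<open>degree 0 = 0\<close> is harmless in the degree condition, as the rank is positive there.
\<close>

definition is_KL_family :: "('a matroid \<Rightarrow> int poly) \<Rightarrow> bool" where
  "is_KL_family P \<longleftrightarrow>
     (\<forall>M. is_matroid M \<longrightarrow> loopless M \<longrightarrow>
        (mrank M = 0 \<longrightarrow> P M = 1) \<and>
        (mrank M > 0 \<longrightarrow> 2 * degree (P M) < mrank M) \<and>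
        reverse_at (mrank M) (P M) =
          (\<Sum>F\<in>flats M. charpoly (mrestrict M F) * P (mcontract M F)))"

text \<open>Outside the loopless matroids the value is unspecified.\<close>

definition KL_poly :: "'a matroid \<Rightarrow> int poly" where
  "KL_poly = (SOME P. is_KL_family P)"

text \<open>
  The unnormalized inverse Kazhdan-Lusztig polynomial. The guard \<open>finite (ground M)\<close>, true for
  every matroid, only serves termination.
\<close>

function inverse_KL_poly :: "'a matroid \<Rightarrow> int poly" where
  "inverse_KL_poly M =
     (if finite (ground M) \<and> mrank M > 0
      then \<Sum>F\<in>{F\<in>flats M. F \<noteq> {}}.
             (-1) ^ (rk M F + 1) * KL_poly (mrestrict M F) * inverse_KL_poly (mcontract M F)
      else 1)"
  by auto
termination
proof (relation "measure (\<lambda>M. card (ground M))")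
  fix M :: "'a matroid" and F
  assume *: "finite (ground M) \<and> mrank M > 0" "F \<in> {F\<in>flats M. F \<noteq> {}}"
  then have "ground M - F \<subset> ground M"
    by (auto simp: flats_def)
  with * show "(mcontract M F, M) \<in> measure (\<lambda>M. card (ground M))"
    by (simp add: mcontract_def psubset_card_mono)
qed simp

declare inverse_KL_poly.simps [simp del]


section \<open>Projective points and the matroids they represent\<close>

text \<open>
  The qualifier \<open>local\<close> is needed because the theory of real vector spaces interprets this
  locale globally and would otherwise capture the names.
\<close>

context vector_space
begin

definition proj_points :: "'b set \<Rightarrow> 'b set set" where
  "proj_points U = {L. subspace L \<and> L \<subseteq> U \<and> dim L = 1}"

text \<open>\<open>point_span E\<close> is the linear span of a set \<open>E\<close> of projective points.\<close>

definition point_span :: "'b set set \<Rightarrow> 'b set" where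
  "point_span E = span (\<Union>E)"

definition point_matroid :: "'b set set \<Rightarrow> 'b set matroid" where
  "point_matroid E = \<lparr>ground = E, rk = (\<lambda>A. dim (local.point_span A))\<rparr>"

definition fin_dim_subspace :: "'b set \<Rightarrow> bool" where
  "fin_dim_subspace V \<longleftrightarrow> subspace V \<and> (\<exists>B. finite B \<and> span B = V)"

definition deletion_setup ::
    "'b set \<Rightarrow> 'b set \<Rightarrow> 'b set \<Rightarrow> 'b set \<Rightarrow> 'b set set \<Rightarrow> bool" where
  "deletion_setup V W Y X S \<longleftrightarrow>
     local.fin_dim_subspace V \<and>
     subspace W \<and> W \<subset> V \<and>
     subspace Y \<and> Y \<subseteq> V \<and>
     subspace X \<and> X \<subseteq> Y \<and> dim Y = dim X + 1 \<and>
     S \<subseteq> (local.proj_points Y - local.proj_points X) - local.proj_points W \<and>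
     local.point_span ((local.proj_points V - local.proj_points W) - S) = V"

text \<open>
  The difference \<open>Q_M - Q_B\<close> with \<open>B = P(V) - P(W)\<close> and \<open>M = B - S\<close>. It may be zero, and then its
  \<open>degree\<close> is 0 instead of minus infinity; this does not affect upper bounds by natural numbers
  or equalities with a positive number.
\<close>

definition inverse_KL_diff :: "'b set \<Rightarrow> 'b set \<Rightarrow> 'b set set \<Rightarrow> int poly" where
  "inverse_KL_diff V W S =
     inverse_KL_poly (local.point_matroid ((local.proj_points V - local.proj_points W) - S)) -
     inverse_KL_poly (local.point_matroid (local.proj_points V - local.proj_points W))"

end

text \<open>
  Every finite-dimensional vector space over the field \<open>'f\<close> is isomorphic to a subspace of the
  space of sequences over \<open>'f\<close>, which therefore serves as ambient space when a
  finite-dimensional space is to be found.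
\<close>

definition seq_scale :: "'f::field \<Rightarrow> (nat \<Rightarrow> 'f) \<Rightarrow> (nat \<Rightarrow> 'f)" where
  "seq_scale c v = (\<lambda>i. c * v i)"

lemma vector_space_seq_scale: "vector_space seq_scale"
  by unfold_locales (auto simp: seq_scale_def fun_eq_iff algebra_simps)

end

theory Submission
  imports Defs "HOL-Library.Cardinality" "HOL-Library.FuncSet"
begin

text \<open>
  In the algebra of functions on loopless matroids under convolution over flats, the
  Kazhdan-Lusztig equation says that the Z-polynomial, the convolution of \<open>t^r\<close> with \<open>P\<close>, is
  palindromic, and the signed inverse Kazhdan-Lusztig polynomial is the convolution of a palindromic
  function with \<open>t^r\<close>.

  For a set \<open>E\<close> of points of \<open>V\<close> one extends the values of the signed inverse polynomial from the
  subspaces spanned by points of \<open>E\<close> to a function \<open>w E\<close> on all subspaces: a subspace \<open>G\<close> whose points of \<open>E\<close> span \<open>G'\<close>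
  gets \<open>t^(dim G - dim G') * w E G'\<close>. By the symmetry of Gaussian binomials the sum of \<open>w E G\<close>
  over all \<open>G \<subseteq> A\<close> is palindromic of centre \<open>dim A / 2\<close>.

  If \<open>E\<close> spans \<open>A\<close>, then \<open>w E A\<close> has degree below \<open>dim A / 2\<close>, so palindromicity bounds its degree
  by the degrees at the proper subspaces of \<open>A\<close>. Induction gives \<open>deg (w B G) \<le> dim (G \<inter> W)\<close> and
  \<open>deg (w M G - w B G) \<le> dim (G \<inter> W \<inter> X) + 1\<close>; subspaces not spanned by points of \<open>M\<close> are handled
  directly, since all their vectors outside \<open>W\<close> and \<open>G'\<close> lie in \<open>Y - X\<close>.

  For sharpness take \<open>W = X\<close> and \<open>S = P(Y) - P(X)\<close>, so that \<open>M = P(V) - P(Y)\<close>. With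
  \<open>dim V = 2 dim Y + 1\<close>, palindromicity of the sum over all subspaces forces the coefficient of
  \<open>t^(dim Y)\<close> in \<open>w M V\<close> to be \<open>-1\<close>.
\<close>

section \<open>Minors and flats\<close>

definition loopless_matroid :: "'a matroid \<Rightarrow> bool" where
  "loopless_matroid M \<longleftrightarrow> is_matroid M \<and> loopless M"

lemma ground_mrestrict [simp]: "ground (mrestrict M F) = F"
  and rk_mrestrict [simp]: "rk (mrestrict M F) = rk M"
  and ground_mcontract [simp]: "ground (mcontract M F) = ground M - F"
  and rk_mcontract [simp]: "rk (mcontract M F) A = rk M (A \<union> F) - rk M F"
  by (simp_all add: mrestrict_def mcontract_def)

lemma mrestrict_mrestrict [simp]: "mrestrict (mrestrict M F) G = mrestrict M G"
  by (simp add: mrestrict_def)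

lemma mrestrict_ground [simp]: "mrestrict M (ground M) = M"
  by (cases M) (simp add: mrestrict_def)

lemma matroid_finite: "is_matroid M \<Longrightarrow> finite (ground M)"
  by (simp add: is_matroid_def)

lemma matroid_rk_mono: "is_matroid M \<Longrightarrow> A \<subseteq> B \<Longrightarrow> B \<subseteq> ground M \<Longrightarrow> rk M A \<le> rk M B"
  by (simp add: is_matroid_def)

lemma matroid_rk_card: "is_matroid M \<Longrightarrow> A \<subseteq> ground M \<Longrightarrow> rk M A \<le> card A"
  by (simp add: is_matroid_def)

lemma matroid_submodular:
  "is_matroid M \<Longrightarrow> A \<subseteq> ground M \<Longrightarrow> B \<subseteq> ground M \<Longrightarrow>
    rk M (A \<union> B) + rk M (A \<inter> B) \<le> rk M A + rk M B"
  by (simp add: is_matroid_def)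

lemma matroid_rk_empty [simp]: "is_matroid M \<Longrightarrow> rk M {} = 0"
  using matroid_rk_card[of M "{}"] by simp

lemma mcontract_empty [simp]:
  assumes "is_matroid M" shows "mcontract M {} = M"
proof (cases M)
  case (fields E r)
  with matroid_rk_empty[OF assms] show ?thesis by (simp add: mcontract_def)
qed

lemma matroid_mrestrict: "is_matroid M \<Longrightarrow> F \<subseteq> ground M \<Longrightarrow> is_matroid (mrestrict M F)"
  unfolding is_matroid_def by (auto intro: finite_subset)

lemma matroid_mcontract:
  assumes M: "is_matroid M" and F: "F \<subseteq> ground M"
  shows "is_matroid (mcontract M F)"
  unfolding is_matroid_def
proof (intro conjI allI impI)
  show "finite (ground (mcontract M F))"
    using matroid_finite[OF M] by simp
next
  fix A assume A: "A \<subseteq> ground (mcontract M F)"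
  then have "rk M (A \<union> F) \<le> rk M A + rk M F"
    using matroid_submodular[OF M, of A F] F by fastforce
  moreover have "rk M A \<le> card A" using matroid_rk_card[OF M] A by auto
  ultimately show "rk (mcontract M F) A \<le> card A" by simp
next
  fix A B assume "A \<subseteq> B" "B \<subseteq> ground (mcontract M F)"
  then have "rk M (A \<union> F) \<le> rk M (B \<union> F)"
    using F by (intro matroid_rk_mono[OF M]) auto
  then show "rk (mcontract M F) A \<le> rk (mcontract M F) B" by simp
next
  fix A B assume A: "A \<subseteq> ground (mcontract M F)" and B: "B \<subseteq> ground (mcontract M F)"
  have eq: "(A \<union> F) \<union> (B \<union> F) = (A \<union> B) \<union> F" "(A \<union> F) \<inter> (B \<union> F) = (A \<inter> B) \<union> F"
    by auto
  have "rk M (A \<union> B \<union> F) + rk M (A \<inter> B \<union> F) \<le> rk M (A \<union> F) + rk M (B \<union> F)"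
    using matroid_submodular[OF M, of "A \<union> F" "B \<union> F"] A B F unfolding eq by auto
  \<comment> \<open>Ranks in the contraction are truncated differences. These bounds make all of
    them genuine, so submodularity survives subtracting \<open>rk M F\<close> twice on each
    side.\<close>
  moreover have "rk M F \<le> rk M (C \<union> F)" if "C \<subseteq> ground M" for C
    using that F by (intro matroid_rk_mono[OF M]) auto
  from this[of "A \<union> B"] this[of "A \<inter> B"] this[of A] this[of B]
  have "rk M F \<le> rk M (A \<union> B \<union> F)" "rk M F \<le> rk M (A \<inter> B \<union> F)"
    "rk M F \<le> rk M (A \<union> F)" "rk M F \<le> rk M (B \<union> F)"
    using A B by auto
  ultimately show "rk (mcontract M F) (A \<union> B) + rk (mcontract M F) (A \<inter> B)
      \<le> rk (mcontract M F) A + rk (mcontract M F) B"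
    by simp
qed

lemma flats_subset: "F \<in> flats M \<Longrightarrow> F \<subseteq> ground M"
  by (simp add: flats_def)

lemma ground_in_flats [simp]: "ground M \<in> flats M"
  by (simp add: flats_def)

lemma finite_flats: "is_matroid M \<Longrightarrow> finite (flats M)"
  by (rule finite_subset[of _ "Pow (ground M)"]) (auto simp: flats_def matroid_finite)

lemma loopless_matroid_mrestrict: "loopless_matroid M \<Longrightarrow> F \<subseteq> ground M \<Longrightarrow> loopless_matroid (mrestrict M F)"
  by (auto simp: loopless_matroid_def loopless_def matroid_mrestrict)

lemma loopless_matroid_mcontract:
  assumes "loopless_matroid M" and F: "F \<in> flats M"
  shows "loopless_matroid (mcontract M F)"
  unfolding loopless_matroid_def
proof
  show "is_matroid (mcontract M F)"
    using matroid_mcontract flats_subset[OF F] assms(1) unfolding loopless_matroid_def by blast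
  show "loopless (mcontract M F)"
    using F by (auto simp: loopless_def flats_def not_le)
qed

lemma empty_in_flats: "loopless_matroid M \<Longrightarrow> {} \<in> flats M"
  by (auto simp: loopless_matroid_def flats_def loopless_def)

lemma flat_rk_less:
  assumes M: "is_matroid M" and F: "F \<in> flats M" and "F \<subset> A" "A \<subseteq> ground M"
  shows "rk M F < rk M A"
proof -
  from \<open>F \<subset> A\<close> obtain e where "e \<in> A" "e \<notin> F" by auto
  then have "rk M F < rk M (insert e F)"
    using F assms(4) by (auto simp: flats_def)
  also have "\<dots> \<le> rk M A"
    using \<open>e \<in> A\<close> \<open>F \<subset> A\<close> assms(4) by (intro matroid_rk_mono[OF M]) auto
  finally show ?thesis .
qed

lemma flat_rk_eq_0_iff: "loopless_matroid M \<Longrightarrow> F \<in> flats M \<Longrightarrow> rk M F = 0 \<longleftrightarrow> F = {}"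
  using flat_rk_less[of M "{}" F] empty_in_flats[of M] flats_subset[of F M]
  by (cases "F = {}") (auto simp: loopless_matroid_def psubset_eq)

lemma mrank_eq_0_iff: "loopless_matroid M \<Longrightarrow> mrank M = 0 \<longleftrightarrow> ground M = {}"
  using flat_rk_eq_0_iff[of M "ground M"] by simp

text \<open>For \<open>e\<close> outside \<open>F\<close>, submodularity for
  \<open>insert e G\<close> and \<open>F\<close>, which meet in \<open>G\<close>, carries the rank
  jump at \<open>F\<close> down to \<open>G\<close>. For \<open>e\<close> inside \<open>F\<close>
  nothing changes.\<close>

lemma flats_mrestrict:
  assumes M: "is_matroid M" and F: "F \<in> flats M"
  shows "flats (mrestrict M F) = {G\<in>flats M. G \<subseteq> F}"
proof (intro set_eqI iffI)
  fix G assume G: "G \<in> flats (mrestrict M F)"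
  then have GF: "G \<subseteq> F" by (simp add: flats_def)
  have FE: "F \<subseteq> ground M" using F by (rule flats_subset)
  have "rk M G < rk M (insert e G)" if e: "e \<in> ground M" "e \<notin> G" for e
  proof (cases "e \<in> F")
    case True
    then show ?thesis using G e by (auto simp: flats_def)
  next
    case False
    have eq: "insert e G \<union> F = insert e F" "insert e G \<inter> F = G" using GF False by auto
    have "rk M F < rk M (insert e F)" using F e False by (auto simp: flats_def)
    moreover have "rk M (insert e F) + rk M G \<le> rk M (insert e G) + rk M F"
      using matroid_submodular[OF M, of "insert e G" F] e GF FE unfolding eq by auto
    ultimately show ?thesis by linarith
  qed
  with GF FE show "G \<in> {G\<in>flats M. G \<subseteq> F}" by (auto simp: flats_def)
next
  fix G assume "G \<in> {G\<in>flats M. G \<subseteq> F}"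
  with flats_subset[OF F] show "G \<in> flats (mrestrict M F)" by (auto simp: flats_def)
qed

lemma flats_mcontract:
  assumes M: "is_matroid M" and F: "F \<in> flats M"
  shows "flats (mcontract M F) = (\<lambda>G. G - F) ` {G\<in>flats M. F \<subseteq> G}"
proof (intro set_eqI iffI)
  fix H assume H: "H \<in> flats (mcontract M F)"
  have FE: "F \<subseteq> ground M" using F by (rule flats_subset)
  have HE: "H \<subseteq> ground M" "H \<inter> F = {}" using H by (auto simp: flats_def)
  have "rk M (H \<union> F) < rk M (insert e (H \<union> F))" if "e \<in> ground M" "e \<notin> H \<union> F" for e
  proof -
    have "rk M (H \<union> F) - rk M F < rk M (insert e (H \<union> F)) - rk M F"
      using H that by (auto simp: flats_def)
    then show ?thesis by linarith
  qed
  then have "H \<union> F \<in> flats M" using HE FE by (auto simp: flats_def)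
  moreover have "H = (H \<union> F) - F" using HE by auto
  ultimately show "H \<in> (\<lambda>G. G - F) ` {G\<in>flats M. F \<subseteq> G}" by blast
next
  fix H assume "H \<in> (\<lambda>G. G - F) ` {G\<in>flats M. F \<subseteq> G}"
  then obtain G where G: "G \<in> flats M" "F \<subseteq> G" "H = G - F" by auto
  have *: "G - F \<union> F = G" using G by auto
  have "rk M F \<le> rk M G" using G by (intro matroid_rk_mono[OF M]) (auto simp: flats_def)
  moreover have "rk M G < rk M (insert e G)" if "e \<in> ground M - G" for e
    using G that by (auto simp: flats_def)
  ultimately show "H \<in> flats (mcontract M F)"
    using G * flats_subset[OF G(1)] by (auto simp: flats_def intro!: diff_less_mono)
qed

lemma mrestrict_mcontract:
  "F \<subseteq> G \<Longrightarrow> mrestrict (mcontract M F) (G - F) = mcontract (mrestrict M G) F"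
  by (simp add: mrestrict_def mcontract_def)

text \<open>The two records are equal, not just isomorphic: \<open>rk M F\<close> cancels in the
  rank of every set. Hence an arbitrary function of matroids takes the same value on both, as
  associativity of convolution requires.\<close>

lemma mcontract_mcontract:
  assumes "is_matroid M" "F \<subseteq> G" "G \<subseteq> ground M"
  shows "mcontract (mcontract M F) (G - F) = mcontract M G"
proof -
  have "rk M F \<le> rk M G" using assms by (intro matroid_rk_mono)
  moreover have "ground M - F - (G - F) = ground M - G" "G - F \<union> F = G"
    "A \<union> (G - F) \<union> F = A \<union> G" for A
    using assms by auto
  ultimately show ?thesis by (simp add: mcontract_def)
qed

section \<open>Convolution of functions on loopless matroids\<close>

text \<open>The product of the incidence algebra of the lattice of flats, for functions whose value
  on an interval is read off from the corresponding minor.\<close>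

definition conv :: "('a matroid \<Rightarrow> int poly) \<Rightarrow> ('a matroid \<Rightarrow> int poly) \<Rightarrow> 'a matroid \<Rightarrow> int poly"
    where
  "conv f g M = (\<Sum>F\<in>flats M. f (mrestrict M F) * g (mcontract M F))"

definition delta :: "'a matroid \<Rightarrow> int poly" where
  "delta M = (if mrank M = 0 then 1 else 0)"

text \<open>Most identities below hold on loopless matroids only, so they cannot be used as
  equations between functions. Rewriting inside \<open>conv\<close> is still sound because both
  minors at a flat are again loopless.\<close>

lemma conv_cong:
  assumes "loopless_matroid M" "\<And>N. loopless_matroid N \<Longrightarrow> f N = f' N" "\<And>N. loopless_matroid N \<Longrightarrow> g N = g' N"
  shows "conv f g M = conv f' g' M"
  unfolding conv_def
  by (intro sum.cong refl arg_cong2[where f = "(*)"] assms(2,3) loopless_matroid_mrestrict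
      loopless_matroid_mcontract assms(1) flats_subset)

text \<open>Both sides are the sum over pairs of flats \<open>G \<subseteq> F\<close> of
  \<open>f\<close> on the restriction to \<open>G\<close>, \<open>g\<close> on the minor between
  \<open>G\<close> and \<open>F\<close>, and \<open>h\<close> on the contraction by
  \<open>F\<close>.\<close>

lemma conv_assoc:
  assumes M: "loopless_matroid M"
  shows "conv (conv f g) h M = conv f (conv g h) M"
proof -
  have M': "is_matroid M" using M by (simp add: loopless_matroid_def)
  have "conv (conv f g) h M =
    (\<Sum>F\<in>flats M. \<Sum>G\<in>{G\<in>flats M. G \<subseteq> F}.
       f (mrestrict M G) * g (mcontract (mrestrict M F) G) * h (mcontract M F))"
    unfolding conv_def by (simp add: flats_mrestrict[OF M'] sum_distrib_right)
  also have "\<dots> = (\<Sum>G\<in>flats M. \<Sum>F\<in>{F\<in>flats M. G \<subseteq> F}.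
       f (mrestrict M G) * g (mcontract (mrestrict M F) G) * h (mcontract M F))"
    by (intro sum.swap_restrict finite_flats M')
  also have "\<dots> = (\<Sum>G\<in>flats M. f (mrestrict M G) * conv g h (mcontract M G))"
  proof (rule sum.cong)
    fix G assume G: "G \<in> flats M"
    have inj: "inj_on (\<lambda>F. F - G) {F\<in>flats M. G \<subseteq> F}"
      by (auto simp: inj_on_def)
    have "conv g h (mcontract M G) = (\<Sum>F\<in>{F\<in>flats M. G \<subseteq> F}.
        g (mrestrict (mcontract M G) (F - G)) * h (mcontract (mcontract M G) (F - G)))"
      unfolding conv_def flats_mcontract[OF M' G] by (subst sum.reindex[OF inj]) simp
    also have "\<dots> = (\<Sum>F\<in>{F\<in>flats M. G \<subseteq> F}.
        g (mcontract (mrestrict M F) G) * h (mcontract M F))"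
      by (intro sum.cong refl)
        (auto simp: mrestrict_mcontract mcontract_mcontract[OF M'] flats_subset)
    finally show "(\<Sum>F\<in>{F\<in>flats M. G \<subseteq> F}.
        f (mrestrict M G) * g (mcontract (mrestrict M F) G) * h (mcontract M F)) =
        f (mrestrict M G) * conv g h (mcontract M G)"
      by (simp add: sum_distrib_left mult.assoc)
  qed simp
  finally show ?thesis by (simp add: conv_def)
qed

lemma conv_split_empty:
  assumes M: "loopless_matroid M"
  shows "conv f g M = f (mrestrict M {}) * g M +
    (\<Sum>F\<in>flats M - {{}}. f (mrestrict M F) * g (mcontract M F))"
  using M unfolding conv_def
  by (subst sum.remove[of _ "{}"]) (auto simp: finite_flats empty_in_flats loopless_matroid_def)

lemma conv_split_ground:
  assumes M: "loopless_matroid M"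
  shows "conv f g M = f M * g (mcontract M (ground M)) +
    (\<Sum>F\<in>flats M - {ground M}. f (mrestrict M F) * g (mcontract M F))"
  using M unfolding conv_def
  by (subst sum.remove[of _ "ground M"]) (auto simp: finite_flats loopless_matroid_def)

lemma mrank_mcontract:
  "loopless_matroid M \<Longrightarrow> F \<in> flats M \<Longrightarrow> mrank (mcontract M F) = mrank M - rk M F"
  by (auto simp: Un_absorb2 flats_subset)

lemma flat_rk_le_mrank: "loopless_matroid M \<Longrightarrow> F \<in> flats M \<Longrightarrow> rk M F \<le> mrank M"
  using matroid_rk_mono[of M F "ground M"] flats_subset[of F M] by (simp add: loopless_matroid_def)

lemma conv_delta_left:
  assumes M: "loopless_matroid M" shows "conv delta f M = f M"
proof -
  have "(\<Sum>F\<in>flats M - {{}}. delta (mrestrict M F) * f (mcontract M F)) = 0"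
    by (intro sum.neutral) (auto simp: delta_def flat_rk_eq_0_iff[OF M])
  with M show ?thesis
    by (simp add: conv_split_empty delta_def loopless_matroid_def)
qed

lemma conv_delta_right:
  assumes M: "loopless_matroid M" shows "conv f delta M = f M"
proof -
  have "delta (mcontract M F) = 0" if "F \<in> flats M - {ground M}" for F
  proof -
    have "F \<subset> ground M" using that flats_subset[of F M] by auto
    then have "rk M F < mrank M" using flat_rk_less[of M F "ground M"] that M
      by (auto simp: loopless_matroid_def)
    then have "mrank (mcontract M F) \<noteq> 0" using that M mrank_mcontract[of M F] by simp
    then show ?thesis by (simp only: delta_def if_False)
  qed
  then have "(\<Sum>F\<in>flats M - {ground M}. f (mrestrict M F) * delta (mcontract M F)) = 0"
    by (intro sum.neutral) auto
  with M show ?thesis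
    by (simp add: conv_split_ground delta_def)
qed

definition unital :: "('a matroid \<Rightarrow> int poly) \<Rightarrow> bool" where
  "unital f \<longleftrightarrow> (\<forall>M. loopless_matroid M \<longrightarrow> mrank M = 0 \<longrightarrow> f M = 1)"

text \<open>The flat \<open>{}\<close> contributes \<open>f M\<close> with factor 1, and all other
  flats contribute values at smaller contractions, which agree by induction.\<close>

lemma conv_cancel_left:
  assumes a: "unital a" and eq: "\<And>N. loopless_matroid N \<Longrightarrow> conv a f N = conv a g N"
    and M: "loopless_matroid M"
  shows "f M = g M"
  using M
proof (induction "card (ground M)" arbitrary: M rule: less_induct)
  case less
  have fin: "finite (ground M)" using less.prems by (auto simp: loopless_matroid_def matroid_finite)
  have "f (mcontract M F) = g (mcontract M F)" if "F \<in> flats M - {{}}" for F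
    using that less.prems fin flats_subset[of F M]
    by (intro less.hyps loopless_matroid_mcontract) (auto intro!: psubset_card_mono)
  moreover have "a (mrestrict M {}) = 1"
    using a less.prems loopless_matroid_mrestrict[of M "{}"] by (auto simp: unital_def loopless_matroid_def)
  ultimately show ?case
    using eq[OF less.prems] by (simp add: conv_split_empty[OF less.prems])
qed

text \<open>Mirror image of the left version: here the flat \<open>ground M\<close> isolates
  \<open>f M\<close> and the other flats give smaller restrictions.\<close>

lemma conv_cancel_right:
  assumes a: "unital a" and eq: "\<And>N. loopless_matroid N \<Longrightarrow> conv f a N = conv g a N"
    and M: "loopless_matroid M"
  shows "f M = g M"
  using M
proof (induction "card (ground M)" arbitrary: M rule: less_induct)
  case less
  have fin: "finite (ground M)" using less.prems by (auto simp: loopless_matroid_def matroid_finite)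
  have "f (mrestrict M F) = g (mrestrict M F)" if "F \<in> flats M - {ground M}" for F
    using that less.prems fin flats_subset[of F M]
    by (intro less.hyps loopless_matroid_mrestrict) (auto intro!: psubset_card_mono)
  moreover have "a (mcontract M (ground M)) = 1"
    using a less.prems loopless_matroid_mcontract[of M "ground M"] by (auto simp: unital_def)
  ultimately show ?case
    using eq[OF less.prems] by (simp add: conv_split_ground[OF less.prems])
qed

lemma unital_conv:
  assumes "unital f" "unital g" shows "unital (conv f g)"
  unfolding unital_def
proof (intro allI impI)
  fix M :: "'a matroid" assume M: "loopless_matroid M" "mrank M = 0"
  then have "ground M = {}" by (simp add: mrank_eq_0_iff)
  then have "flats M = {{}}" "mrestrict M {} = M"
    using M mrestrict_ground[of M] by (auto simp: flats_def)
  with assms M show "conv f g M = 1"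
    by (simp add: conv_def unital_def loopless_matroid_def)
qed

text \<open>By associativity \<open>f * (g * f) = (f * g) * f = f = f * delta\<close>, written with
  \<open>*\<close> for \<open>conv\<close>. Cancelling \<open>f\<close> on the left gives the
  claim.\<close>

lemma conv_inverse_commute:
  assumes f: "unital f" and fg: "\<And>N. loopless_matroid N \<Longrightarrow> conv f g N = delta N" and M: "loopless_matroid M"
  shows "conv g f M = delta M"
proof (rule conv_cancel_left[OF f _ M])
  fix N :: "'a matroid" assume N: "loopless_matroid N"
  have "conv f (conv g f) N = conv (conv f g) f N" by (rule conv_assoc[OF N, symmetric])
  also have "\<dots> = conv delta f N" by (rule conv_cong[OF N]) (auto simp: fg)
  also have "\<dots> = conv f delta N" by (simp add: conv_delta_left conv_delta_right N)
  finally show "conv f (conv g f) N = conv f delta N" .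
qed

section \<open>Reversal of polynomials at a prescribed degree\<close>

lemma coeff_reverse_at:
  assumes "degree p \<le> r"
  shows "coeff (reverse_at r p) i = (if i \<le> r then coeff p (r - i) else 0)"
proof -
  have "coeff p (r - i) = 0" if "i < r - degree p" using that by (intro coeff_eq_0) auto
  moreover have "degree p - (i - (r - degree p)) = r - i" if "r - degree p \<le> i" "i \<le> r"
    using that assms by auto
  ultimately show ?thesis
    using assms by (auto simp: reverse_at_def coeff_monom_mult coeff_reflect_poly)
qed

lemma degree_reverse_at: "degree p \<le> r \<Longrightarrow> degree (reverse_at r p) \<le> r"
  by (rule degree_le) (simp add: coeff_reverse_at)

lemma reverse_at_add:
  "degree p \<le> r \<Longrightarrow> degree q \<le> r \<Longrightarrow> reverse_at r (p + q) = reverse_at r p + reverse_at r q"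
  by (rule poly_eqI) (auto simp: coeff_reverse_at degree_add_le)

lemma reverse_at_0 [simp]: "reverse_at r 0 = 0"
  by (simp add: reverse_at_def)

lemma reverse_at_sum:
  assumes "\<And>x. x \<in> A \<Longrightarrow> degree (f x) \<le> r"
  shows "reverse_at r (sum f A) = (\<Sum>x\<in>A. reverse_at r (f x))"
  using assms
  by (induction A rule: infinite_finite_induct) (auto simp: reverse_at_add degree_sum_le)

lemma reverse_at_mult:
  assumes "degree p \<le> r" "degree q \<le> s"
  shows "reverse_at (r + s) (p * q) = reverse_at r p * reverse_at s q"
proof (cases "p = 0 \<or> q = 0")
  case False
  then have "r + s - degree (p * q) = (r - degree p) + (s - degree q)"
    using assms by (simp add: degree_mult_eq)
  then show ?thesis
    by (simp add: reverse_at_def reflect_poly_mult mult_ac)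
      (simp add: mult_monom)
qed auto

lemma reverse_at_monom: "k \<le> r \<Longrightarrow> reverse_at r (monom c k) = monom c (r - k)"
  by (rule poly_eqI) (auto simp: coeff_reverse_at degree_monom_le order_trans[OF degree_monom_le])

text \<open>Under this bound \<open>reverse_at\<close> at the rank really mirrors the coefficients.
  For a larger degree the subtraction in \<open>reverse_at\<close> would be truncated.\<close>

definition graded :: "('a matroid \<Rightarrow> int poly) \<Rightarrow> bool" where
  "graded f \<longleftrightarrow> (\<forall>M. loopless_matroid M \<longrightarrow> degree (f M) \<le> mrank M)"

definition reversed :: "('a matroid \<Rightarrow> int poly) \<Rightarrow> 'a matroid \<Rightarrow> int poly" where
  "reversed f M = reverse_at (mrank M) (f M)"

definition signed :: "('a matroid \<Rightarrow> int poly) \<Rightarrow> 'a matroid \<Rightarrow> int poly" where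
  "signed f M = (-1) ^ mrank M * f M"

lemma mrank_flat_sum:
  "loopless_matroid M \<Longrightarrow> F \<in> flats M \<Longrightarrow> mrank (mrestrict M F) + mrank (mcontract M F) = mrank M"
  using mrank_mcontract[of M F] flat_rk_le_mrank[of M F] by simp

lemma gradedD: "graded f \<Longrightarrow> loopless_matroid M \<Longrightarrow> degree (f M) \<le> mrank M"
  by (simp add: graded_def)

lemma degree_mult_flat:
  assumes "graded f" "graded g" "loopless_matroid M" "F \<in> flats M"
  shows "degree (f (mrestrict M F) * g (mcontract M F)) \<le> mrank M"
  unfolding mrank_flat_sum[OF assms(3,4), symmetric]
  using assms by (intro order_trans[OF degree_mult_le] add_mono gradedD loopless_matroid_mrestrict
      loopless_matroid_mcontract flats_subset)

lemma graded_conv: "graded f \<Longrightarrow> graded g \<Longrightarrow> graded (conv f g)"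
  unfolding graded_def[of "conv f g"] conv_def
  by (intro allI impI degree_sum_le finite_flats degree_mult_flat) (auto simp: loopless_matroid_def)

lemma graded_reversed: "graded f \<Longrightarrow> graded (reversed f)"
  by (simp add: graded_def reversed_def degree_reverse_at)

text \<open>Rank is additive along a flat, so the reversal of each summand splits into the reversals
  of its two factors. Reversal is thus multiplicative for convolution.\<close>

lemma reversed_conv:
  assumes f: "graded f" and g: "graded g" and M: "loopless_matroid M"
  shows "reversed (conv f g) M = conv (reversed f) (reversed g) M"
proof -
  have "reversed (conv f g) M =
    (\<Sum>F\<in>flats M. reverse_at (mrank M) (f (mrestrict M F) * g (mcontract M F)))"
    unfolding reversed_def conv_def by (intro reverse_at_sum degree_mult_flat f g M)
  also have "\<dots> = conv (reversed f) (reversed g) M"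
    unfolding conv_def
  proof (rule sum.cong)
    fix F assume F: "F \<in> flats M"
    show "reverse_at (mrank M) (f (mrestrict M F) * g (mcontract M F)) =
        reversed f (mrestrict M F) * reversed g (mcontract M F)"
      unfolding mrank_flat_sum[OF M F, symmetric] reversed_def
      using M F by (intro reverse_at_mult gradedD[OF f] gradedD[OF g] loopless_matroid_mrestrict
          loopless_matroid_mcontract flats_subset)
  qed simp
  finally show ?thesis .
qed

text \<open>Additivity of the rank along a flat also splits the sign.\<close>

lemma signed_conv:
  assumes M: "loopless_matroid M"
  shows "signed (conv f g) M = conv (signed f) (signed g) M"
  unfolding signed_def[of "conv f g"] conv_def sum_distrib_left
proof (rule sum.cong)
  fix F assume F: "F \<in> flats M"
  show "(- 1) ^ mrank M * (f (mrestrict M F) * g (mcontract M F)) =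
      signed f (mrestrict M F) * signed g (mcontract M F)"
    unfolding mrank_flat_sum[OF M F, symmetric] signed_def power_add by (simp only: mult_ac)
qed simp

lemma signed_signed [simp]: "signed (signed f) M = f M"
proof -
  have "((- 1 :: int poly) ^ mrank M) * ((- 1) ^ mrank M * f M) = f M"
    unfolding mult.assoc[symmetric] power_mult_distrib[symmetric] by simp
  then show ?thesis by (simp add: signed_def)
qed

lemma degree_signed [simp]: "degree (signed f M) = degree (f M)"
  by (cases "even (mrank M)") (simp_all add: signed_def)

lemma graded_signed: "graded f \<Longrightarrow> graded (signed f)"
  by (simp add: graded_def)

lemma unital_signed: "unital f \<Longrightarrow> unital (signed f)"
  by (simp add: unital_def signed_def)

lemma signed_delta [simp]: "signed delta M = delta M"
  by (simp add: signed_def delta_def)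

lemma reversed_delta [simp]: "reversed delta M = delta M"
  by (simp add: reversed_def delta_def reverse_at_def)

section \<open>The zeta function, its reversal and the Moebius function\<close>

definition zeta_fun :: "'a matroid \<Rightarrow> int poly" where "zeta_fun M = 1"

definition tau_fun :: "'a matroid \<Rightarrow> int poly" where "tau_fun M = monom 1 (mrank M)"

definition moebius_fun :: "'a matroid \<Rightarrow> int poly" where
  "moebius_fun M = [:moebius (flats M) {} (ground M):]"

lemma unital_basic: "unital zeta_fun" "unital tau_fun" "unital moebius_fun"
proof -
  show "unital zeta_fun" "unital tau_fun" by (simp_all add: unital_def zeta_fun_def tau_fun_def one_poly_eq_simps)
  show "unital moebius_fun"
    by (auto simp: unital_def moebius_fun_def mrank_eq_0_iff moebius.simps one_pCons)
qed

lemma graded_basic: "graded zeta_fun" "graded tau_fun" "graded moebius_fun"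
  by (simp_all add: graded_def zeta_fun_def tau_fun_def moebius_fun_def degree_monom_le)

lemma reversed_zeta_fun: "reversed zeta_fun M = tau_fun M"
  by (simp add: reversed_def zeta_fun_def tau_fun_def reverse_at_def)

lemma reversed_tau_fun: "reversed tau_fun M = zeta_fun M"
  by (simp add: reversed_def zeta_fun_def tau_fun_def reverse_at_monom)

text \<open>The recursion for the value at \<open>B\<close> visits only members of the family below
  \<open>B\<close>, so removing members that are not below \<open>F\<close> changes nothing.\<close>

lemma moebius_mono_family:
  assumes "finite B" "B \<subseteq> F"
  shows "moebius {C\<in>L. C \<subseteq> F} A B = moebius L A B"
  using assms
proof (induction B rule: finite_psubset_induct)
  case (psubset B)
  have "{C\<in>{C\<in>L. C \<subseteq> F}. A \<subseteq> C \<and> C \<subset> B} = {C\<in>L. A \<subseteq> C \<and> C \<subset> B}"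
    using psubset.prems by auto
  moreover have "(\<Sum>C\<in>{C\<in>L. A \<subseteq> C \<and> C \<subset> B}. moebius {C\<in>L. C \<subseteq> F} A C) =
      (\<Sum>C\<in>{C\<in>L. A \<subseteq> C \<and> C \<subset> B}. moebius L A C)"
    using psubset by (intro sum.cong) auto
  ultimately show ?case
    by (simp add: moebius.simps[of _ A B])
qed

lemma moebius_fun_mrestrict:
  assumes M: "loopless_matroid M" and F: "F \<in> flats M"
  shows "moebius_fun (mrestrict M F) = [:moebius (flats M) {} F:]"
  using M F finite_subset[OF flats_subset[OF F] matroid_finite]
  by (auto simp: moebius_fun_def flats_mrestrict loopless_matroid_def moebius_mono_family)

lemma charpoly_conv:
  assumes M: "loopless_matroid M"
  shows "charpoly M = conv moebius_fun tau_fun M"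
  unfolding charpoly_def conv_def
proof (rule sum.cong)
  fix F assume F: "F \<in> flats M"
  show "monom (moebius (flats M) {} F) (mrank M - rk M F) =
      moebius_fun (mrestrict M F) * tau_fun (mcontract M F)"
    unfolding moebius_fun_mrestrict[OF M F] tau_fun_def mrank_mcontract[OF M F]
    by (simp add: smult_monom)
qed simp

text \<open>On a nonempty ground set the value at the top flat is by recursion minus the sum of all
  other values, so the total is 0.\<close>

lemma conv_moebius_fun_zeta_fun:
  assumes M: "loopless_matroid M"
  shows "conv moebius_fun zeta_fun M = delta M"
proof -
  have fin: "finite (flats M)" "finite (ground M)"
    using M by (auto simp: loopless_matroid_def finite_flats matroid_finite)
  have "conv moebius_fun zeta_fun M = (\<Sum>F\<in>flats M. [:moebius (flats M) {} F:])"
    unfolding conv_def by (intro sum.cong) (auto simp: moebius_fun_mrestrict[OF M] zeta_fun_def)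
  also have "\<dots> = [:\<Sum>F\<in>flats M. moebius (flats M) {} F:]"
    by (rule sum_to_poly)
  also have "(\<Sum>F\<in>flats M. moebius (flats M) {} F) = (if ground M = {} then 1 else 0)"
  proof (cases "ground M = {}")
    case True
    then have "flats M = {{}}" by (auto simp: flats_def)
    then show ?thesis using True by (simp add: moebius.simps)
  next
    case False
    have "flats M = insert (ground M) {C\<in>flats M. {} \<subseteq> C \<and> C \<subset> ground M}"
      using flats_subset[of _ M] by auto
    then have "(\<Sum>F\<in>flats M. moebius (flats M) {} F) =
      (\<Sum>F\<in>insert (ground M) {C\<in>flats M. {} \<subseteq> C \<and> C \<subset> ground M}. moebius (flats M) {} F)"
      by simp
    also have "\<dots> = moebius (flats M) {} (ground M) +
      (\<Sum>C\<in>{C\<in>flats M. {} \<subseteq> C \<and> C \<subset> ground M}. moebius (flats M) {} C)"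
      using fin(1) by (intro sum.insert) auto
    also have "\<dots> = 0"
      using False fin by (simp add: moebius.simps[of _ "{}" "ground M"] psubset_eq)
    finally show ?thesis using False by simp
  qed
  finally show ?thesis using M by (auto simp: delta_def mrank_eq_0_iff one_pCons)
qed

lemma conv_zeta_fun_moebius_fun: "loopless_matroid M \<Longrightarrow> conv zeta_fun moebius_fun M = delta M"
  using conv_inverse_commute[OF unital_basic(3) conv_moebius_fun_zeta_fun] .

section \<open>Kazhdan-Lusztig polynomials and their inverses\<close>

lemma is_KL_family_iff:
  "is_KL_family P \<longleftrightarrow>
    (\<forall>M. loopless_matroid M \<longrightarrow> (mrank M = 0 \<longrightarrow> P M = 1) \<and>
       (mrank M > 0 \<longrightarrow> 2 * degree (P M) < mrank M) \<and>
       reversed P M = conv charpoly P M)"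
  by (auto simp: is_KL_family_def loopless_matroid_def reversed_def conv_def)

text \<open>Reversing \<open>conv tau_fun P\<close> turns it into
  \<open>conv zeta_fun (reversed P)\<close>. If this equals \<open>conv tau_fun P\<close>,
  multiplying by \<open>moebius_fun\<close> on the left leaves \<open>reversed P\<close> on one side
  and \<open>charpoly\<close> convolved with \<open>P\<close> on the other.\<close>

lemma palindromic_imp_KL_equation:
  assumes P: "graded P" and pal: "\<And>N. loopless_matroid N \<Longrightarrow> reversed (conv tau_fun P) N = conv tau_fun P N"
    and M: "loopless_matroid M"
  shows "reversed P M = conv charpoly P M"
proof -
  have eq: "conv zeta_fun (reversed P) N = conv tau_fun P N" if "loopless_matroid N" for N
  proof -
    have "conv zeta_fun (reversed P) N = conv (reversed tau_fun) (reversed P) N"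
      by (rule conv_cong[OF that]) (auto simp: reversed_tau_fun)
    also have "\<dots> = conv tau_fun P N"
      using reversed_conv[OF graded_basic(2) P that] pal[OF that] by simp
    finally show ?thesis .
  qed
  have "reversed P M = conv delta (reversed P) M" by (simp add: conv_delta_left[OF M])
  also have "\<dots> = conv (conv moebius_fun zeta_fun) (reversed P) M"
    by (rule conv_cong[OF M]) (auto simp: conv_moebius_fun_zeta_fun)
  also have "\<dots> = conv moebius_fun (conv zeta_fun (reversed P)) M" by (rule conv_assoc[OF M])
  also have "\<dots> = conv moebius_fun (conv tau_fun P) M" by (rule conv_cong[OF M]) (auto simp: eq)
  also have "\<dots> = conv (conv moebius_fun tau_fun) P M" by (rule conv_assoc[OF M, symmetric])
  also have "\<dots> = conv charpoly P M" by (rule conv_cong[OF M]) (auto simp: charpoly_conv)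
  finally show ?thesis .
qed

text \<open>The computation of the converse read backwards, now multiplying by
  \<open>zeta_fun\<close> on the left.\<close>

lemma KL_equation_imp_palindromic:
  assumes P: "graded P" and KL: "\<And>N. loopless_matroid N \<Longrightarrow> reversed P N = conv charpoly P N"
    and M: "loopless_matroid M"
  shows "reversed (conv tau_fun P) M = conv tau_fun P M"
proof -
  have eq: "reversed P N = conv moebius_fun (conv tau_fun P) N" if "loopless_matroid N" for N
    unfolding KL[OF that] conv_assoc[OF that, symmetric]
    by (rule conv_cong[OF that]) (auto simp: charpoly_conv)
  have "reversed (conv tau_fun P) M = conv zeta_fun (reversed P) M"
    unfolding reversed_conv[OF graded_basic(2) P M] by (rule conv_cong[OF M]) (auto simp: reversed_tau_fun)
  also have "\<dots> = conv zeta_fun (conv moebius_fun (conv tau_fun P)) M"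
    by (rule conv_cong[OF M]) (auto simp: eq)
  also have "\<dots> = conv (conv zeta_fun moebius_fun) (conv tau_fun P) M" by (rule conv_assoc[OF M, symmetric])
  also have "\<dots> = conv delta (conv tau_fun P) M"
    by (rule conv_cong[OF M]) (auto simp: conv_zeta_fun_moebius_fun)
  also have "\<dots> = conv tau_fun P M" by (rule conv_delta_left[OF M])
  finally show ?thesis .
qed

text \<open>
  The lower half of \<open>P\<close> in \<open>P + R\<close> is forced by asking for a palindromic sum.
\<close>

definition palindromic_correction :: "nat \<Rightarrow> int poly \<Rightarrow> int poly" where
  "palindromic_correction r R = (\<Sum>i | 2 * i < r. monom (coeff R (r - i) - coeff R i) i)"

lemma coeff_palindromic_correction:
  "coeff (palindromic_correction r R) i = (if 2 * i < r then coeff R (r - i) - coeff R i else 0)"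
proof -
  have "finite {i. 2 * i < r}" by (rule finite_subset[of _ "{..<r}"]) auto
  then show ?thesis
    by (simp add: palindromic_correction_def coeff_sum)
qed

lemma degree_palindromic_correction:
  assumes "r > 0" shows "2 * degree (palindromic_correction r R) < r"
proof -
  have "degree (palindromic_correction r R) \<le> (r - 1) div 2"
    using assms by (intro degree_le) (auto simp: coeff_palindromic_correction)
  with assms show ?thesis by linarith
qed

text \<open>Below the middle, coefficient \<open>i\<close> of the sum collapses to coefficient
  \<open>r - i\<close> of \<open>R\<close>. Above the middle the correction vanishes, and a middle
  coefficient is its own mirror image.\<close>

lemma reverse_at_palindromic_correction:
  assumes "degree R \<le> r"
  shows "reverse_at r (palindromic_correction r R + R) = palindromic_correction r R + R"
proof -
  let ?p = "palindromic_correction r R + R"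
  have deg: "degree ?p \<le> r"
    using assms by (intro degree_add_le degree_le) (auto simp: coeff_palindromic_correction coeff_eq_0)
  show ?thesis
  proof (rule poly_eqI)
    fix i
    consider "i > r" | "2 * i = r" | "i \<le> r" "2 * i < r" | "i \<le> r" "2 * i > r" by linarith
    then show "coeff (reverse_at r ?p) i = coeff ?p i"
    proof cases
      case 1
      then show ?thesis using deg coeff_eq_0[of ?p i] by (simp only: coeff_reverse_at if_False) simp
    next
      case 2
      then have "i \<le> r" "r - i = i" by auto
      then show ?thesis using deg by (simp add: coeff_reverse_at)
    qed (use deg in \<open>auto simp: coeff_reverse_at coeff_palindromic_correction\<close>)
  qed
qed

text \<open>In the convolution of \<open>tau_fun\<close> with the wanted family, the flat
  \<open>{}\<close> contributes the polynomial of \<open>M\<close> itself, while the remaining sum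
  involves only proper contractions. The correction of that sum is a choice of degree below half the
  rank making the total palindromic.\<close>

function KL_witness :: "'a matroid \<Rightarrow> int poly" where
  "KL_witness M =
     (if finite (ground M) \<and> mrank M > 0
      then palindromic_correction (mrank M)
        (\<Sum>F\<in>flats M - {{}}. monom 1 (rk M F) * KL_witness (mcontract M F))
      else 1)"
  by auto
termination
proof (relation "measure (\<lambda>M. card (ground M))")
  fix M :: "'a matroid" and F
  assume *: "finite (ground M) \<and> mrank M > 0" "F \<in> flats M - {{}}"
  then have "ground M - F \<subset> ground M"
    by (auto simp: flats_def)
  with * show "(mcontract M F, M) \<in> measure (\<lambda>M. card (ground M))"
    by (simp add: mcontract_def psubset_card_mono)
qed simp

declare KL_witness.simps [simp del]

lemma KL_witness_degree:
  assumes "loopless_matroid M" "mrank M > 0" shows "2 * degree (KL_witness M) < mrank M"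
  using assms matroid_finite[of M]
  by (simp add: KL_witness.simps[of M] degree_palindromic_correction loopless_matroid_def)

lemma KL_witness_rank_0: "mrank M = 0 \<Longrightarrow> KL_witness M = 1"
  by (simp add: KL_witness.simps)

lemma graded_KL_witness: "graded KL_witness"
  unfolding graded_def
proof (intro allI impI)
  fix M :: "'a matroid" assume "loopless_matroid M"
  then show "degree (KL_witness M) \<le> mrank M"
    using KL_witness_degree[of M] KL_witness_rank_0[of M] by (cases "mrank M = 0") auto
qed

lemma KL_witness_palindromic:
  fixes M :: "'a matroid"
  assumes M: "loopless_matroid M"
  shows "reversed (conv tau_fun KL_witness) M = conv tau_fun KL_witness M"
proof (cases "mrank M = 0")
  case True
  have "unital (conv tau_fun (KL_witness :: 'a matroid \<Rightarrow> _))"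
    by (intro unital_conv unital_basic) (simp add: unital_def KL_witness_rank_0)
  with True M have "conv tau_fun KL_witness M = 1" unfolding unital_def by blast
  with True show ?thesis by (simp add: reversed_def reverse_at_def)
next
  case False
  define R where "R = (\<Sum>F\<in>flats M - {{}}. tau_fun (mrestrict M F) * KL_witness (mcontract M F))"
  have "degree R \<le> mrank M"
    unfolding R_def using M
    by (intro degree_sum_le degree_mult_flat graded_basic graded_KL_witness)
      (auto simp: finite_flats loopless_matroid_def)
  moreover have "conv tau_fun KL_witness M = palindromic_correction (mrank M) R + R"
  proof -
    have "KL_witness M = palindromic_correction (mrank M) R"
      using False M matroid_finite[of M]
      by (subst KL_witness.simps) (auto simp: R_def tau_fun_def loopless_matroid_def)
    moreover have "tau_fun (mrestrict M {}) = 1"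
      using M by (simp add: tau_fun_def loopless_matroid_def)
    ultimately show ?thesis
      unfolding conv_split_empty[OF M] R_def[symmetric] by simp
  qed
  ultimately show ?thesis
    by (simp add: reversed_def reverse_at_palindromic_correction)
qed

lemma is_KL_family_KL_witness: "is_KL_family KL_witness"
  unfolding is_KL_family_iff
  using KL_witness_rank_0 KL_witness_degree
    palindromic_imp_KL_equation[OF graded_KL_witness KL_witness_palindromic] by blast

text \<open>\<open>KL_poly\<close> is defined by choice, so a concrete family is exhibited first.
  From here on only the defining conditions enter.\<close>

lemma is_KL_family_KL_poly: "is_KL_family KL_poly"
  unfolding KL_poly_def by (rule someI[where P = is_KL_family, OF is_KL_family_KL_witness])

lemma KL_poly_rank_0: "loopless_matroid M \<Longrightarrow> mrank M = 0 \<Longrightarrow> KL_poly M = 1"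
  and KL_poly_degree: "loopless_matroid M \<Longrightarrow> mrank M > 0 \<Longrightarrow> 2 * degree (KL_poly M) < mrank M"
  and KL_poly_equation: "loopless_matroid M \<Longrightarrow> reversed KL_poly M = conv charpoly KL_poly M"
  using is_KL_family_KL_poly unfolding is_KL_family_iff by blast+

lemma KL_poly_degree_le: "loopless_matroid M \<Longrightarrow> 2 * degree (KL_poly M) \<le> mrank M"
  using KL_poly_degree[of M] KL_poly_rank_0[of M] by (cases "mrank M = 0") auto

lemma inverse_KL_rank_0: "mrank M = 0 \<Longrightarrow> inverse_KL_poly M = 1"
  by (simp add: inverse_KL_poly.simps)

text \<open>Each summand of the recursion has a nonempty flat, so its Kazhdan-Lusztig factor stays
  strictly below half the rank of the flat. The inverse factor is at most half the remaining rank by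
  induction.\<close>

lemma inverse_KL_degree_le: "loopless_matroid M \<Longrightarrow> 2 * degree (inverse_KL_poly M) \<le> mrank M"
  and inverse_KL_degree: "loopless_matroid M \<Longrightarrow> mrank M > 0 \<Longrightarrow> 2 * degree (inverse_KL_poly M) < mrank M"
proof -
  have *: "2 * degree (inverse_KL_poly M) \<le> mrank M \<and>
      (mrank M > 0 \<longrightarrow> 2 * degree (inverse_KL_poly M) < mrank M)" if "loopless_matroid M" for M :: "'a matroid"
    using that
  proof (induction "card (ground M)" arbitrary: M rule: less_induct)
    case less
    have fin: "finite (ground M)" using less.prems by (auto simp: loopless_matroid_def matroid_finite)
    show ?case
    proof (cases "mrank M = 0")
      case True
      then show ?thesis by (simp add: inverse_KL_rank_0)
    next
      case False
      have "2 * degree ((-1) ^ (rk M F + 1) * KL_poly (mrestrict M F) * inverse_KL_poly (mcontract M F))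
          < mrank M" if F: "F \<in> flats M" "F \<noteq> {}" for F
      proof -
        have lm: "loopless_matroid (mrestrict M F)" "loopless_matroid (mcontract M F)"
          using loopless_matroid_mrestrict[OF less.prems flats_subset[OF F(1)]]
            loopless_matroid_mcontract[OF less.prems F(1)] by simp_all
        have "mrank (mrestrict M F) > 0"
          using flat_rk_eq_0_iff[OF less.prems F(1)] F by simp
        then have "2 * degree (KL_poly (mrestrict M F)) < mrank (mrestrict M F)"
          by (rule KL_poly_degree[OF lm(1)])
        moreover have "2 * degree (inverse_KL_poly (mcontract M F)) \<le> mrank (mcontract M F)"
        proof -
          have "ground M - F \<subset> ground M" using F flats_subset[of F M] by auto
          then have "card (ground (mcontract M F)) < card (ground M)"
            using fin by (simp add: psubset_card_mono)
          from less.hyps[OF this lm(2)] show ?thesis by blast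
        qed
        moreover have "degree ((-1) ^ (rk M F + 1) * KL_poly (mrestrict M F) * inverse_KL_poly (mcontract M F))
            \<le> degree (KL_poly (mrestrict M F)) + degree (inverse_KL_poly (mcontract M F))"
          by (cases "even (rk M F)") (simp_all add: degree_mult_le)
        ultimately show ?thesis using mrank_flat_sum[OF less.prems F(1)] by linarith
      qed
      note bound = this
      \<comment> \<open>The strict bound is rewritten as a weak one, the form in which degree bounds
        pass to sums. It is equivalent since the rank is positive.\<close>
      have "degree (inverse_KL_poly M) \<le> (mrank M - 1) div 2"
        unfolding inverse_KL_poly.simps[of M] if_P[OF conjI[OF fin False[unfolded neq0_conv]]]
      proof (rule degree_sum_le)
        show "finite {F\<in>flats M. F \<noteq> {}}"
          using finite_flats[of M] less.prems by (simp add: loopless_matroid_def)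
      qed (use bound in fastforce)
      then show ?thesis using False by auto
    qed
  qed
  show "loopless_matroid M \<Longrightarrow> 2 * degree (inverse_KL_poly M) \<le> mrank M"
    "loopless_matroid M \<Longrightarrow> mrank M > 0 \<Longrightarrow> 2 * degree (inverse_KL_poly M) < mrank M"
    using * by blast+
qed

text \<open>The recursion for the inverse polynomial with all terms on one side: the flat
  \<open>{}\<close> supplies the left-hand side.\<close>

lemma conv_signed_KL_inverse:
  fixes M :: "'a matroid"
  assumes M: "loopless_matroid M" shows "conv (signed KL_poly) inverse_KL_poly M = delta M"
proof (cases "mrank M = 0")
  case True
  have "unital (conv (signed KL_poly) (inverse_KL_poly :: 'a matroid \<Rightarrow> _))"
    by (intro unital_conv unital_signed)
      (auto simp: unital_def KL_poly_rank_0 inverse_KL_rank_0)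
  then show ?thesis using True M unfolding unital_def by (simp add: delta_def)
next
  case False
  have fin: "finite (ground M)" using M by (auto simp: loopless_matroid_def matroid_finite)
  have "signed KL_poly (mrestrict M {}) = 1"
    using M loopless_matroid_mrestrict[of M "{}"] KL_poly_rank_0[of "mrestrict M {}"]
    by (simp add: signed_def loopless_matroid_def)
  moreover have "{F\<in>flats M. F \<noteq> {}} = flats M - {{}}" by auto
  ultimately show ?thesis
    unfolding conv_split_empty[OF M] using False fin
    by (subst inverse_KL_poly.simps) (auto simp: delta_def signed_def sum.distrib[symmetric])
qed

text \<open>
  This is the convolution inverse of the Z-polynomial \<open>conv tau_fun KL_poly\<close>. It is palindromic
  because the Z-polynomial is.
\<close>

definition Z_inverse :: "'a matroid \<Rightarrow> int poly" where
  "Z_inverse = conv (signed inverse_KL_poly) (reversed moebius_fun)"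

lemma graded_inverse_KL: "graded inverse_KL_poly"
  using inverse_KL_degree_le unfolding graded_def by fastforce

lemma graded_KL: "graded KL_poly"
  using KL_poly_degree_le unfolding graded_def by fastforce

lemma unital_KL: "unital KL_poly" "unital inverse_KL_poly"
  by (simp_all add: unital_def KL_poly_rank_0 inverse_KL_rank_0)

lemma graded_Z_inverse: "graded Z_inverse"
  unfolding Z_inverse_def
  by (intro graded_conv graded_signed graded_inverse_KL graded_reversed graded_basic)

text \<open>This is the reversal of the inversion formula for \<open>moebius_fun\<close> and
  \<open>zeta_fun\<close>, as \<open>tau_fun\<close> is the reversal of
  \<open>zeta_fun\<close>.\<close>

lemma conv_reversed_moebius_fun_tau_fun: "loopless_matroid M \<Longrightarrow> conv (reversed moebius_fun) tau_fun M = delta M"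
proof -
  assume M: "loopless_matroid M"
  have "conv (reversed moebius_fun) tau_fun M = conv (reversed moebius_fun) (reversed zeta_fun) M"
    by (rule conv_cong[OF M]) (auto simp: reversed_zeta_fun)
  also have "\<dots> = reversed (conv moebius_fun zeta_fun) M"
    by (rule reversed_conv[OF graded_basic(3,1) M, symmetric])
  also have "\<dots> = delta M"
    unfolding reversed_def conv_moebius_fun_zeta_fun[OF M] by (simp add: delta_def reverse_at_def)
  finally show ?thesis .
qed

text \<open>\<open>tau_fun\<close> cancels the factor \<open>reversed moebius_fun\<close> in
  \<open>Z_inverse\<close>. This factorization into a palindromic function and powers of
  \<open>t\<close> is what the geometric part uses.\<close>

lemma signed_inverse_KL_eq:
  assumes M: "loopless_matroid M"
  shows "signed inverse_KL_poly M = conv Z_inverse tau_fun M"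
proof -
  have "conv Z_inverse tau_fun M = conv (signed inverse_KL_poly) (conv (reversed moebius_fun) tau_fun) M"
    unfolding Z_inverse_def by (rule conv_assoc[OF M])
  also have "\<dots> = conv (signed inverse_KL_poly) delta M"
    by (rule conv_cong[OF M]) (auto simp: conv_reversed_moebius_fun_tau_fun)
  finally show ?thesis by (simp add: conv_delta_right[OF M])
qed

text \<open>Signs are multiplicative, so the sign can be moved from one factor to the other. The
  resulting right inverse of \<open>KL_poly\<close> is also a left inverse.\<close>

lemma conv_signed_inverse_KL:
  assumes M: "loopless_matroid M" shows "conv (signed inverse_KL_poly) KL_poly M = delta M"
proof -
  have "conv KL_poly (signed inverse_KL_poly) N = delta N" if N: "loopless_matroid N" for N :: "'a matroid"
  proof -
    have "conv KL_poly (signed inverse_KL_poly) N =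
        conv (signed (signed KL_poly)) (signed inverse_KL_poly) N"
      by (rule conv_cong[OF N]) auto
    also have "\<dots> = signed (conv (signed KL_poly) inverse_KL_poly) N"
      by (rule signed_conv[OF N, symmetric])
    also have "\<dots> = delta N"
      using signed_delta[of N] by (simp add: signed_def conv_signed_KL_inverse[OF N])
    finally show ?thesis .
  qed
  from conv_inverse_commute[OF unital_KL(1) this M] show ?thesis .
qed

text \<open>Since the Z-polynomial is palindromic, \<open>Z_inverse\<close> and its reversal are
  both left inverses of it, hence equal by cancellation.\<close>

lemma reversed_Z_inverse:
  assumes M: "loopless_matroid M" shows "reversed Z_inverse M = Z_inverse M"
proof -
  let ?Z = "conv tau_fun KL_poly"
  have pal: "reversed ?Z N = ?Z N" if "loopless_matroid N" for N :: "'a matroid"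
    using KL_equation_imp_palindromic[OF graded_KL KL_poly_equation that] .
  have gZ: "graded ?Z" by (intro graded_conv graded_basic graded_KL)
  have uZ: "unital ?Z" by (intro unital_conv unital_basic unital_KL)
  have inv: "conv Z_inverse ?Z N = delta N" if N: "loopless_matroid N" for N :: "'a matroid"
  proof -
    have "conv Z_inverse ?Z N = conv (conv Z_inverse tau_fun) KL_poly N"
      by (rule conv_assoc[OF N, symmetric])
    also have "\<dots> = conv (signed inverse_KL_poly) KL_poly N"
      by (rule conv_cong[OF N]) (auto simp: signed_inverse_KL_eq)
    finally show ?thesis by (simp add: conv_signed_inverse_KL[OF N])
  qed
  show ?thesis
  proof (rule conv_cancel_right[OF uZ _ M])
    fix N :: "'a matroid" assume N: "loopless_matroid N"
    have "conv (reversed Z_inverse) ?Z N = conv (reversed Z_inverse) (reversed ?Z) N"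
      by (rule conv_cong[OF N]) (auto simp: pal)
    also have "\<dots> = reversed (conv Z_inverse ?Z) N"
      by (rule reversed_conv[OF graded_Z_inverse gZ N, symmetric])
    also have "\<dots> = delta N" using reversed_delta[of N] by (simp add: reversed_def inv[OF N])
    finally show "conv (reversed Z_inverse) ?Z N = conv Z_inverse ?Z N"
      by (simp add: inv[OF N])
  qed
qed

section \<open>Vector spaces over finite fields\<close>

locale finite_field_space = vector_space scale
  for scale :: "'f::{field,finite} \<Rightarrow> 'v::ab_group_add \<Rightarrow> 'v" (infixr \<open>*s\<close> 75)
begin

text \<open>Over a finite field, finite-dimensional subspaces are the finite ones. Dimension facts
  can then be proved by counting vectors.\<close>

definition fin_subspace :: "'v set \<Rightarrow> bool" where
  "fin_subspace U \<longleftrightarrow> subspace U \<and> finite U"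

lemma q_gt_1: "CARD('f) > 1"
proof -
  have "card {0, 1 :: 'f} \<le> CARD('f)" by (rule card_mono) auto
  then show ?thesis by simp
qed

lemma span_insert_eq_image: "span (insert b S) = (\<lambda>(c, x). c *s b + x) ` (UNIV \<times> span S)"
proof (intro set_eqI iffI)
  fix x assume "x \<in> span (insert b S)"
  then obtain k where "x - k *s b \<in> span S" by (auto simp: span_insert)
  then have "x = (\<lambda>(c, x). c *s b + x) (k, x - k *s b)" "(k, x - k *s b) \<in> UNIV \<times> span S" by auto
  then show "x \<in> (\<lambda>(c, x). c *s b + x) ` (UNIV \<times> span S)" by blast
next
  fix x assume "x \<in> (\<lambda>(c, x). c *s b + x) ` (UNIV \<times> span S)"
  then obtain c y where y: "x = c *s b + y" "y \<in> span S" by auto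
  then have "x - c *s b \<in> span S" by simp
  then show "x \<in> span (insert b S)" by (auto simp: span_insert)
qed

text \<open>The representation \<open>c *s b + x\<close> with \<open>x\<close> in the span is
  unique: otherwise a nonzero multiple of \<open>b\<close>, and so \<open>b\<close> itself, would
  lie in the span.\<close>

lemma card_span_insert:
  assumes "b \<notin> span S"
  shows "card (span (insert b S)) = CARD('f) * card (span S)"
proof -
  have "inj_on (\<lambda>(c, x). c *s b + x) (UNIV \<times> span S)"
  proof (rule inj_onI, clarify)
    fix c x d y assume *: "x \<in> span S" "y \<in> span S" "c *s b + x = d *s b + y"
    then have "(c - d) *s b = y - x" by (simp add: scale_left_diff_distrib algebra_simps)
    then have cd: "(c - d) *s b \<in> span S" using * by (simp add: span_diff)
    have "c = d"
    proof (rule ccontr)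
      assume "c \<noteq> d"
      then have "b = inverse (c - d) *s (c - d) *s b" by simp
      then show False using span_scale[OF cd] assms by metis
    qed
    then show "c = d \<and> x = y" using * by auto
  qed
  then show ?thesis
    by (simp add: span_insert_eq_image card_image card_cartesian_product)
qed

lemma finite_span: "finite B \<Longrightarrow> finite (span B)"
  by (induction B rule: finite_induct) (auto simp: span_insert_eq_image)

lemma card_span_independent:
  assumes "finite B" "independent B" shows "card (span B) = CARD('f) ^ card B"
  using assms
proof (induction B rule: finite_induct)
  case (insert b B)
  then have "b \<notin> span B" "independent B" by (auto simp: independent_insert split: if_splits)
  with insert show ?case by (simp add: card_span_insert)
qed simp

lemma fin_subspaceD: "fin_subspace U \<Longrightarrow> subspace U" "fin_subspace U \<Longrightarrow> finite U"
  by (simp_all add: fin_subspace_def)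

lemma fin_subspace_subset: "fin_subspace U \<Longrightarrow> subspace T \<Longrightarrow> T \<subseteq> U \<Longrightarrow> fin_subspace T"
  by (auto simp: fin_subspace_def intro: finite_subset)

lemma fin_subspace_Int: "fin_subspace U \<Longrightarrow> subspace T \<Longrightarrow> fin_subspace (U \<inter> T)"
  by (auto simp: fin_subspace_def subspace_inter)

lemma fin_subspace_span: "finite B \<Longrightarrow> fin_subspace (span B)"
  by (simp add: fin_subspace_def finite_span)

lemma card_fin_subspace:
  assumes "fin_subspace U" shows "card U = CARD('f) ^ dim U"
proof -
  obtain B where B: "B \<subseteq> U" "independent B" "U \<subseteq> span B" "card B = dim U"
    using basis_exists by blast
  have "finite B" using B assms by (auto simp: fin_subspace_def intro: finite_subset)
  moreover have "span B = U" using B assms span_minimal[of B U] by (auto simp: fin_subspace_def)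
  ultimately show ?thesis using B card_span_independent by fastforce
qed

lemma dim_eq_iff_card_eq: "fin_subspace U \<Longrightarrow> card U = CARD('f) ^ n \<longleftrightarrow> dim U = n"
  using q_gt_1 by (simp add: card_fin_subspace)

lemma dim_mono_fin:
  assumes "fin_subspace U" "fin_subspace T" "U \<subseteq> T" shows "dim U \<le> dim T"
proof -
  have "CARD('f) ^ dim U \<le> CARD('f) ^ dim T"
    using assms card_mono[of T U] by (simp add: card_fin_subspace fin_subspace_def)
  then show ?thesis using q_gt_1 by simp
qed

lemma subspace_dim_eq_fin:
  assumes "fin_subspace U" "fin_subspace T" "U \<subseteq> T" "dim T \<le> dim U" shows "U = T"
proof (rule card_subset_eq)
  have "dim U = dim T" using dim_mono_fin[OF assms(1-3)] assms(4) by simp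
  then show "card U = card T" using assms by (simp add: card_fin_subspace)
qed (use assms in \<open>auto simp: fin_subspace_def\<close>)

lemma dim_strict_mono_fin:
  assumes "fin_subspace U" "fin_subspace T" "U \<subset> T" shows "dim U < dim T"
  using subspace_dim_eq_fin[OF assms(1,2)] assms(3) by (auto simp: psubset_eq not_le[symmetric])

lemma fin_subspace_span_insert: "fin_subspace U \<Longrightarrow> fin_subspace (span (insert a U))"
  by (simp add: fin_subspace_span fin_subspaceD)

lemma span_fin_subspace [simp]: "fin_subspace U \<Longrightarrow> span U = U"
  by (simp add: fin_subspace_def)

lemma dim_span_insert_fin:
  assumes U: "fin_subspace U" and "a \<notin> U"
  shows "dim (span (insert a U)) = Suc (dim U)"
  using card_span_insert[of a U] assms dim_eq_iff_card_eq[OF fin_subspace_span_insert[OF U], of a "Suc (dim U)"]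
  by (simp add: card_fin_subspace)

text \<open>\<open>U\<close> lies in the span of \<open>T\<close> and the single vector
  \<open>g\<close>. The later estimates supply the scalar \<open>c\<close> vector by vector.\<close>

lemma dim_le_Suc:
  assumes "fin_subspace U" "fin_subspace T" and "\<And>x. x \<in> U \<Longrightarrow> \<exists>c. x - c *s g \<in> T"
  shows "dim U \<le> Suc (dim T)"
proof -
  have "U \<subseteq> span (insert g T)" using assms by (auto simp: span_insert)
  then have "dim U \<le> dim (span (insert g T))"
    using assms by (intro dim_mono_fin fin_subspace_span_insert)
  also have "\<dots> \<le> Suc (dim T)"
    using dim_span_insert_fin[OF assms(2), of g] assms(2)
    by (cases "g \<in> T") (simp_all add: insert_absorb)
  finally show ?thesis .
qed

lemma hyperplane_decompose:
  assumes "fin_subspace X" "fin_subspace Y" "X \<subseteq> Y" "dim Y = Suc (dim X)"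
    and "y \<in> Y" "y \<notin> X" "z \<in> Y"
  shows "\<exists>c. z - c *s y \<in> X"
proof -
  have "span (insert y X) \<subseteq> Y"
    using assms by (intro span_minimal) (auto simp: fin_subspace_def)
  then have "span (insert y X) = Y"
    using assms by (intro subspace_dim_eq_fin) (auto simp: dim_span_insert_fin fin_subspace_span_insert simp del: dim_span)
  then show ?thesis using \<open>z \<in> Y\<close> assms(1) by (auto simp: span_insert)
qed

lemma subspace_sum_set: "subspace U \<Longrightarrow> subspace T \<Longrightarrow> span (U \<union> T) = (\<lambda>(x, y). x + y) ` (U \<times> T)"
  by (force simp: span_Un span_eq_iff[THEN iffD2] image_def)

text \<open>Addition maps \<open>U \<times> T\<close> onto the sum, and each fibre is a translate of
  a copy of \<open>U \<inter> T\<close>. Counting pairs and comparing exponents of the field size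
  gives the modular law.\<close>

lemma dim_sum_Int:
  assumes U: "fin_subspace U" and T: "fin_subspace T"
  shows "dim (span (U \<union> T)) + dim (U \<inter> T) = dim U + dim T"
proof -
  let ?S = "span (U \<union> T)" let ?f = "\<lambda>(x, y). x + y"
  have S: "fin_subspace ?S" using U T by (intro fin_subspace_span) (auto simp: fin_subspace_def)
  have I: "fin_subspace (U \<inter> T)" using U T by (intro fin_subspace_Int) (auto simp: fin_subspace_def)
  have eq: "?S = ?f ` (U \<times> T)" using U T by (intro subspace_sum_set) (auto simp: fin_subspace_def)
  have fib: "card {p\<in>U \<times> T. ?f p = s} = card (U \<inter> T)" if s: "s \<in> ?S" for s
  proof -
    obtain x y where xy: "x \<in> U" "y \<in> T" "s = x + y" using s unfolding eq by auto
    have "bij_betw (\<lambda>z. (x + z, y - z)) (U \<inter> T) {p\<in>U \<times> T. ?f p = s}"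
    proof (rule bij_betwI[where g = "\<lambda>p. fst p - x"])
      show "(\<lambda>z. (x + z, y - z)) \<in> U \<inter> T \<rightarrow> {p\<in>U \<times> T. ?f p = s}"
        using xy U T by (auto simp: fin_subspace_def subspace_add subspace_diff)
      show "(\<lambda>p. fst p - x) \<in> {p\<in>U \<times> T. ?f p = s} \<rightarrow> U \<inter> T"
      proof
        fix p assume "p \<in> {p\<in>U \<times> T. ?f p = s}"
        then obtain a b where p: "p = (a, b)" "a \<in> U" "b \<in> T" "a + b = x + y"
          using xy by auto
        have "a - x = y - b" using p(4) by (simp add: algebra_simps)
        moreover have "a - x \<in> U" "y - b \<in> T"
          using p xy U T by (auto simp: fin_subspace_def intro!: subspace_diff)
        ultimately have "a - x \<in> U" "a - x \<in> T" by simp_all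
        then show "fst p - x \<in> U \<inter> T" using p by simp
      qed
    qed (use xy in \<open>auto simp: algebra_simps\<close>)
    then show ?thesis by (simp add: bij_betw_same_card)
  qed
  have "card U * card T = card (U \<times> T)" by (simp add: card_cartesian_product)
  also have "\<dots> = (\<Sum>s\<in>?S. card {p\<in>U \<times> T. ?f p = s})"
    using U T S eq sum.group[of "U \<times> T" ?S ?f "\<lambda>_. 1 :: nat"] by (auto simp: fin_subspace_def)
  also have "\<dots> = card ?S * card (U \<inter> T)" using fib by simp
  finally have "CARD('f) ^ (dim U + dim T) = CARD('f) ^ (dim ?S + dim (U \<inter> T))"
    using U T S I by (simp add: card_fin_subspace power_add del: dim_span)
  then show ?thesis using q_gt_1 by (simp del: dim_span)
qed

lemma exists_between:
  assumes F: "fin_subspace F" and A: "fin_subspace A" and "F \<subseteq> A" "dim F \<le> d" "d \<le> dim A"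
  shows "\<exists>H. fin_subspace H \<and> F \<subseteq> H \<and> H \<subseteq> A \<and> dim H = d"
  using \<open>dim F \<le> d\<close> \<open>d \<le> dim A\<close>
proof (induction d rule: dec_induct)
  case base
  then show ?case using F \<open>F \<subseteq> A\<close> by blast
next
  case (step d)
  then obtain H where H: "fin_subspace H" "F \<subseteq> H" "H \<subseteq> A" "dim H = d" by auto
  with step have "H \<noteq> A" by auto
  with H obtain a where a: "a \<in> A" "a \<notin> H" by auto
  have "span (insert a H) \<subseteq> A" using a H A by (intro span_minimal) (auto simp: fin_subspace_def)
  moreover have "F \<subseteq> span (insert a H)" using H span_superset by blast
  ultimately show ?case
    using H a dim_span_insert_fin[OF H(1) a(2)] fin_subspace_span_insert[OF H(1)] by metis
qed

text \<open>With \<open>x\<close> in \<open>G\<close> outside \<open>S\<close> and \<open>y\<close>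
  in \<open>G\<close> outside \<open>T\<close>, one of \<open>x\<close>, \<open>y\<close>,
  \<open>x + y\<close> avoids both.\<close>

lemma subspace_not_subset_Un:
  assumes "subspace G" "subspace S" "subspace T" "\<not> G \<subseteq> S" "\<not> G \<subseteq> T"
  obtains g where "g \<in> G" "g \<notin> S" "g \<notin> T"
proof -
  obtain x y where xy: "x \<in> G" "x \<notin> S" "y \<in> G" "y \<notin> T" using assms by auto
  have "x + y \<in> G" using xy assms by (simp add: subspace_add)
  moreover have "x + y \<notin> S" if "y \<in> S" using that xy assms subspace_diff[of S "x + y" y] by auto
  moreover have "x + y \<notin> T" if "x \<in> T" using that xy assms subspace_diff[of T "x + y" x] by auto
  ultimately show ?thesis using that xy by blast
qed

text \<open>Fixing \<open>g\<close> in \<open>G - S\<close>, every \<open>x\<close> in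
  \<open>G \<inter> S\<close> is the difference of \<open>x + g\<close> and \<open>g\<close>, both
  outside \<open>S\<close>.\<close>

lemma span_complement:
  assumes "subspace G" "subspace S" "\<not> G \<subseteq> S"
  shows "span (G - S) = G"
proof
  show "span (G - S) \<subseteq> G" using assms by (intro span_minimal) auto
  obtain g where g: "g \<in> G" "g \<notin> S" using assms by auto
  show "G \<subseteq> span (G - S)"
  proof
    fix x assume x: "x \<in> G"
    show "x \<in> span (G - S)"
    proof (cases "x \<in> S")
      case True
      then have "x + g \<notin> S" using g assms subspace_diff[of S "x + g" x] by auto
      then have "x + g \<in> span (G - S)" "g \<in> span (G - S)"
        using x g assms by (auto intro!: span_base simp: subspace_add)
      then show ?thesis using span_diff by fastforce
    qed (use x in \<open>auto intro: span_base\<close>)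
  qed
qed

end

text \<open>Gaussian binomials, by the Pascal rule that splits subspaces according to whether they
  lie in a fixed hyperplane.\<close>

fun gauss :: "nat \<Rightarrow> nat \<Rightarrow> nat \<Rightarrow> nat" where
  "gauss q 0 0 = 1"
| "gauss q 0 (Suc k) = 0"
| "gauss q (Suc n) 0 = 1"
| "gauss q (Suc n) (Suc k) = gauss q n (Suc k) + q ^ (n - k) * gauss q n k"

lemma gauss_eq_0: "n < k \<Longrightarrow> gauss q n k = 0"
proof (induction n arbitrary: k)
  case 0
  then show ?case by (cases k) auto
next
  case (Suc n)
  then show ?case by (cases k) auto
qed

lemma gauss_0_right [simp]: "gauss q n 0 = 1"
  by (cases n) auto

lemma gauss_self [simp]: "gauss q n n = 1"
  by (induction n) (auto simp: gauss_eq_0)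

text \<open>The q-factorial without its denominators \<open>q - 1\<close>, over the integers so that
  the subtraction is genuine.\<close>

definition qfact :: "nat \<Rightarrow> nat \<Rightarrow> int" where
  "qfact q n = (\<Prod>i<n. int q ^ Suc i - 1)"

lemma qfact_Suc: "qfact q (Suc n) = qfact q n * (int q ^ Suc n - 1)"
  by (simp add: qfact_def)

lemma qfact_neq_0: "q > 1 \<Longrightarrow> qfact q n \<noteq> 0"
proof (induction n)
  case (Suc n)
  assume "q > 1"
  then have "int q ^ Suc n > 1" by (intro one_less_power) auto
  with Suc show ?case by (simp add: qfact_Suc)
qed (simp add: qfact_def)

lemma gauss_qfact:
  "k \<le> n \<Longrightarrow> int (gauss q n k) * (qfact q k * qfact q (n - k)) = qfact q n"
proof (induction n arbitrary: k)
  case 0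
  then show ?case by (simp add: qfact_def)
next
  case (Suc n)
  show ?case
  proof (cases k)
    case 0
    then show ?thesis by (simp add: qfact_def)
  next
    case (Suc j)
    show ?thesis
    proof (cases "j = n")
      case True
      then show ?thesis using Suc by (simp add: gauss_eq_0 qfact_def)
    next
      case False
      then have j: "j < n" using Suc \<open>k \<le> Suc n\<close> by simp
      define m where "m = n - Suc j"
      have m: "n - j = Suc m" "Suc n - Suc j = Suc m" "n - Suc j = m" using j by (auto simp: m_def)
      let ?Q = "int q"
      have 1: "int (gauss q n (Suc j)) * (qfact q (Suc j) * qfact q m) = qfact q n"
        using Suc.IH[of "Suc j"] j m by simp
      have 2: "int (gauss q n j) * (qfact q j * qfact q (Suc m)) = qfact q n"
        using Suc.IH[of j] j m by simp
      \<comment> \<open>With \<open>Q\<close> for \<open>?Q\<close>, the induction rests on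
        \<open>(Q^(m+1) - 1) + Q^(m+1) * (Q^(j+1) - 1) = Q^(n+1) - 1\<close>, where
        \<open>n = m + j + 1\<close>.\<close>
      have "int (gauss q (Suc n) (Suc j)) * (qfact q (Suc j) * qfact q (Suc m)) =
         (int (gauss q n (Suc j)) * (qfact q (Suc j) * qfact q m)) * (?Q ^ Suc m - 1) +
         ?Q ^ Suc m * (?Q ^ Suc j - 1) * (int (gauss q n j) * (qfact q j * qfact q (Suc m)))"
        by (simp only: gauss.simps m of_nat_add of_nat_mult of_nat_power qfact_Suc[of q j]
            qfact_Suc[of q m]) (simp only: algebra_simps)
      also have "\<dots> = qfact q n * (?Q ^ Suc m * ?Q ^ Suc j - 1)"
        unfolding 1 2 by (simp only: algebra_simps)
      also have "?Q ^ Suc m * ?Q ^ Suc j = ?Q ^ Suc n"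
        using j by (simp only: power_add[symmetric]) (simp add: m_def)
      finally show ?thesis using Suc m by (simp only: qfact_Suc[of q n] m)
    qed
  qed
qed

lemma gauss_symmetric:
  assumes "q > 1" "k \<le> n" shows "gauss q n (n - k) = gauss q n k"
proof -
  have "int (gauss q n (n - k)) * (qfact q (n - k) * qfact q k) = int (gauss q n k) * (qfact q k * qfact q (n - k))"
    using gauss_qfact[of k n q] gauss_qfact[of "n - k" n q] assms by simp
  then show ?thesis using qfact_neq_0[OF assms(1)] by (simp add: mult.commute)
qed

section \<open>Counting the subspaces between two given ones\<close>

context finite_field_space
begin

text \<open>Taking \<open>{}\<close> for \<open>F\<close> yields all subspaces of
  \<open>A\<close>.\<close>

definition subspaces_between :: "'v set \<Rightarrow> 'v set \<Rightarrow> 'v set set" where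
  "subspaces_between F A = {G. subspace G \<and> F \<subseteq> G \<and> G \<subseteq> A}"

lemma finite_subspaces_between: "fin_subspace A \<Longrightarrow> finite (subspaces_between F A)"
  by (rule finite_subset[of _ "Pow A"]) (auto simp: subspaces_between_def fin_subspace_def)

lemma subspaces_between_fin: "fin_subspace A \<Longrightarrow> G \<in> subspaces_between F A \<Longrightarrow> fin_subspace G"
  by (auto simp: subspaces_between_def intro: fin_subspace_subset)

text \<open>Fix \<open>a\<close> in \<open>A\<close> outside \<open>H\<close>. Each such
  \<open>G\<close> meets the translate \<open>a + H\<close> in a coset of \<open>K\<close>, and
  these cosets partition \<open>a + H\<close>, so their number is \<open>card H\<close> divided by
  \<open>card K\<close>.\<close>

lemma card_transversal_subspaces:
  assumes A: "fin_subspace A" and H: "fin_subspace H" "H \<subseteq> A" "dim A = Suc (dim H)"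
    and K: "fin_subspace K" "K \<subseteq> H"
  shows "card {G. subspace G \<and> G \<subseteq> A \<and> \<not> G \<subseteq> H \<and> G \<inter> H = K} = CARD('f) ^ (dim H - dim K)"
proof -
  let ?\<Phi> = "{G. subspace G \<and> G \<subseteq> A \<and> \<not> G \<subseteq> H \<and> G \<inter> H = K}"
  have sub: "subspace A" "subspace H" "subspace K" using A H K by (auto simp: fin_subspace_def)
  have "H \<noteq> A" using H by auto
  then obtain a where a: "a \<in> A" "a \<notin> H" using H by auto
  have dec: "\<exists>c. z - c *s y \<in> H" if "y \<in> A" "y \<notin> H" "z \<in> A" for y z
    using hyperplane_decompose[OF H(1) A H(2,3)] that by blast
  have aH: "a + h \<in> A" "a + h \<notin> H" if "h \<in> H" for h
    using that a sub H subspace_add[of A a h] subspace_diff[of H "a + h" h] by auto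
  have fib: "card {h\<in>H. a + h \<in> G} = card K" if G: "G \<in> ?\<Phi>" for G
  proof -
    from G obtain g where g: "g \<in> G" "g \<notin> H" "g \<in> A" by auto
    obtain c where c: "a - c *s g \<in> H" using dec[OF g(3,2) a(1)] by auto
    define h0 where "h0 = c *s g - a"
    have h0: "h0 \<in> H" using subspace_neg[OF sub(2) c] by (simp add: h0_def)
    have ah0: "a + h0 \<in> G" using G g by (simp add: h0_def subspace_scale)
    have "{h\<in>H. a + h \<in> G} = (+) h0 ` K"
    proof (intro set_eqI iffI)
      fix h assume h: "h \<in> {h\<in>H. a + h \<in> G}"
      have "h - h0 \<in> H" using h h0 sub by (simp add: subspace_diff)
      moreover have "(a + h) - (a + h0) \<in> G" using h ah0 G by (intro subspace_diff) auto
      ultimately have "h - h0 \<in> K" using G by auto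
      then show "h \<in> (+) h0 ` K" by (auto intro!: image_eqI[of _ _ "h - h0"])
    next
      fix h assume "h \<in> (+) h0 ` K"
      then obtain k where k: "k \<in> K" "h = h0 + k" by auto
      then have "k \<in> G" "k \<in> H" using G by auto
      have "subspace G" using G by simp
      then have "a + h0 + k \<in> G" by (rule subspace_add[OF _ ah0 \<open>k \<in> G\<close>])
      then show "h \<in> {h\<in>H. a + h \<in> G}" using k(2) subspace_add[OF sub(2) h0 \<open>k \<in> H\<close>] by (simp add: add.assoc)
    qed
    then show ?thesis by (simp add: card_image)
  qed
  have "H = (\<Union>G\<in>?\<Phi>. {h\<in>H. a + h \<in> G})"
  proof (intro set_eqI iffI)
    fix h assume h: "h \<in> H"
    \<comment> \<open>The unique transversal subspace through \<open>a + h\<close> with trace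
      \<open>K\<close> on \<open>H\<close>.\<close>
    let ?G = "span (insert (a + h) K)"
    have "?G \<subseteq> A" using aH(1)[OF h] K H sub by (intro span_minimal) auto
    moreover have "a + h \<in> ?G" by (simp add: span_base)
    moreover have "?G \<inter> H = K"
    proof (intro equalityI subsetI)
      fix x assume "x \<in> ?G \<inter> H"
      then obtain k where x: "x \<in> H" "x - k *s (a + h) \<in> K" using K by (auto simp: span_insert)
      then have "x - k *s (a + h) \<in> H" using K by auto
      then have "x - (x - k *s (a + h)) \<in> H" by (rule subspace_diff[OF sub(2) x(1)])
      then have kH: "k *s (a + h) \<in> H" by simp
      have "k = 0"
      proof (rule ccontr)
        assume "k \<noteq> 0"
        then have "a + h = inverse k *s k *s (a + h)" by simp
        then show False using subspace_scale[OF sub(2) kH, of "inverse k"] aH(2)[OF h] by metis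
      qed
      then show "x \<in> K" using x by simp
    next
      fix x assume "x \<in> K"
      then show "x \<in> ?G \<inter> H" using K by (auto intro: span_base)
    qed
    ultimately have "?G \<in> ?\<Phi>" using aH(2)[OF h] by auto
    then show "h \<in> (\<Union>G\<in>?\<Phi>. {h\<in>H. a + h \<in> G})" using h \<open>a + h \<in> ?G\<close> by blast
  qed auto
  moreover have "card (\<Union>G\<in>?\<Phi>. {h\<in>H. a + h \<in> G}) = (\<Sum>G\<in>?\<Phi>. card {h\<in>H. a + h \<in> G})"
  proof (rule card_UN_disjoint)
    show "finite ?\<Phi>" by (rule finite_subset[of _ "Pow A"]) (use A in \<open>auto simp: fin_subspace_def\<close>)
    show "\<forall>G\<in>?\<Phi>. finite {h\<in>H. a + h \<in> G}" using H by (auto simp: fin_subspace_def)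
    \<comment> \<open>A transversal subspace is generated by \<open>K\<close> and any one of its
      vectors \<open>a + h\<close>, so two of them sharing such a vector coincide.\<close>
    have mem: "x \<in> G'" if G: "G \<in> ?\<Phi>" "G' \<in> ?\<Phi>" and h: "h \<in> H" "a + h \<in> G" "a + h \<in> G'"
      and x: "x \<in> G" for G G' h x
    proof -
      obtain c where c: "x - c *s (a + h) \<in> H" using dec[OF aH[OF h(1)], of x] G x by auto
      have subG: "subspace G" "subspace G'" using G by simp_all
      have "x - c *s (a + h) \<in> G"
        by (rule subspace_diff[OF subG(1) x subspace_scale[OF subG(1) h(2)]])
      with c have "x - c *s (a + h) \<in> G'" using G by blast
      from subspace_add[OF subG(2) this subspace_scale[OF subG(2) h(3)]]
      have "x - c *s (a + h) + c *s (a + h) \<in> G'" .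
      then show ?thesis by simp
    qed
    show "\<forall>G\<in>?\<Phi>. \<forall>G'\<in>?\<Phi>. G \<noteq> G' \<longrightarrow> {h\<in>H. a + h \<in> G} \<inter> {h\<in>H. a + h \<in> G'} = {}"
    proof (intro ballI impI, rule ccontr)
      fix G G' assume G: "G \<in> ?\<Phi>" "G' \<in> ?\<Phi>" "G \<noteq> G'"
        and "{h\<in>H. a + h \<in> G} \<inter> {h\<in>H. a + h \<in> G'} \<noteq> {}"
      then obtain h where h: "h \<in> H" "a + h \<in> G" "a + h \<in> G'" by auto
      have "G = G'" using mem[OF G(1,2) h] mem[OF G(2,1) h(1,3,2)] by blast
      with G show False by simp
    qed
  qed
  ultimately have "card H = card ?\<Phi> * card K" using fib by simp
  moreover have "dim K \<le> dim H" using dim_mono_fin K H by blast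
  then have "CARD('f) ^ dim H = CARD('f) ^ (dim H - dim K) * CARD('f) ^ dim K"
    by (simp flip: power_add)
  ultimately show ?thesis using q_gt_1 H K by (simp add: card_fin_subspace)
qed

text \<open>Induction through a hyperplane \<open>H\<close> of \<open>A\<close> containing
  \<open>F\<close>: subspaces inside \<open>H\<close> are counted by induction, the others are
  grouped by their trace on \<open>H\<close>, one dimension lower. This reproduces the recursion of
  \<open>gauss\<close>.\<close>

lemma card_subspaces_between:
  assumes A: "fin_subspace A" and F: "fin_subspace F" "F \<subseteq> A"
  shows "card {G\<in>subspaces_between F A. dim G = dim F + k} = gauss CARD('f) (dim A - dim F) k"
  using A F(2)
proof (induction "dim A - dim F" arbitrary: A k)
  case 0
  then have "A = F" using subspace_dim_eq_fin[OF F(1) 0(2,3)] by simp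
  then have "{G\<in>subspaces_between F A. dim G = dim F + k} = (if k = 0 then {F} else {})"
    using fin_subspaceD[OF F(1)] by (auto simp: subspaces_between_def)
  then show ?case using \<open>A = F\<close> by (cases k) (simp_all only: if_True if_False simp_thms, simp_all)
next
  case (Suc n)
  then have n: "Suc (dim F + n) = dim A" by auto
  then obtain H where H: "fin_subspace H" "F \<subseteq> H" "H \<subseteq> A" "dim H = dim F + n"
    using exists_between[OF F(1) Suc(3,4), of "dim F + n"] by auto
  have dH: "dim A = Suc (dim H)" using H n by simp
  let ?S = "\<lambda>A k. {G\<in>subspaces_between F A. dim G = dim F + k}"
  have IH: "card (?S H k) = gauss CARD('f) n k" for k
    using Suc(1)[of H k] H by simp
  have finS: "finite (?S A k)" for k using finite_subspaces_between[OF Suc(3), of F] by simp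
  show ?case
  proof (cases k)
    case 0
    have "?S A 0 = {F}"
    proof (intro equalityI subsetI)
      fix G assume G: "G \<in> ?S A 0"
      then have "fin_subspace G" using subspaces_between_fin[OF \<open>fin_subspace A\<close>] by blast
      then show "G \<in> {F}"
        using subspace_dim_eq_fin[OF F(1), of G] G by (simp add: subspaces_between_def)
    qed (use \<open>F \<subseteq> A\<close> fin_subspaceD[OF F(1)] in \<open>auto simp: subspaces_between_def\<close>)
    then show ?thesis using 0 by simp
  next
    case (Suc j)
    let ?T = "\<lambda>K. {G. subspace G \<and> G \<subseteq> A \<and> \<not> G \<subseteq> H \<and> G \<inter> H = K}"
    have dimInt: "dim G = Suc (dim (G \<inter> H))" if G: "fin_subspace G" "G \<subseteq> A" "\<not> G \<subseteq> H" for G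
    proof -
      obtain g where g: "g \<in> G" "g \<notin> H" using G by auto
      have I: "fin_subspace (G \<inter> H)" using G H fin_subspace_Int fin_subspaceD by blast
      have "dim G \<le> Suc (dim (G \<inter> H))"
      proof (rule dim_le_Suc[OF G(1) I])
        fix x assume x: "x \<in> G"
        obtain c where "x - c *s g \<in> H"
          using hyperplane_decompose[OF H(1) \<open>fin_subspace A\<close> H(3) dH, of g x] g x G by auto
        moreover have "x - c *s g \<in> G"
          using x g G by (intro subspace_diff subspace_scale) (auto simp: fin_subspace_def)
        ultimately show "\<exists>c. x - c *s g \<in> G \<inter> H" by auto
      qed
      moreover have "dim (G \<inter> H) < dim G" using G by (intro dim_strict_mono_fin I) auto
      ultimately show ?thesis by simp
    qed
    have split: "?S A (Suc j) = ?S H (Suc j) \<union> (\<Union>K\<in>?S H j. ?T K)"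
    proof (intro equalityI subsetI)
      fix G assume G: "G \<in> ?S A (Suc j)"
      then have finG: "fin_subspace G" using subspaces_between_fin \<open>fin_subspace A\<close> by auto
      show "G \<in> ?S H (Suc j) \<union> (\<Union>K\<in>?S H j. ?T K)"
      proof (cases "G \<subseteq> H")
        case True
        then show ?thesis using G by (auto simp: subspaces_between_def)
      next
        case False
        then have "dim (G \<inter> H) = dim F + j" using dimInt[OF finG] G by (auto simp: subspaces_between_def)
        then have "G \<inter> H \<in> ?S H j" "G \<in> ?T (G \<inter> H)"
          using G H False fin_subspaceD by (auto simp: subspaces_between_def subspace_inter)
        then show ?thesis by blast
      qed
    next
      fix G assume "G \<in> ?S H (Suc j) \<union> (\<Union>K\<in>?S H j. ?T K)"
      then show "G \<in> ?S A (Suc j)"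
      proof
        assume "G \<in> (\<Union>K\<in>?S H j. ?T K)"
        then obtain K where K: "K \<in> ?S H j" "subspace G" "G \<subseteq> A" "\<not> G \<subseteq> H" "G \<inter> H = K" by auto
        then have "dim G = Suc (dim K)"
          using dimInt[of G] fin_subspace_subset[OF \<open>fin_subspace A\<close>] by auto
        then show ?thesis using K by (auto simp: subspaces_between_def)
      qed (use H in \<open>auto simp: subspaces_between_def\<close>)
    qed
    have "card (?S A (Suc j)) = card (?S H (Suc j)) + card (\<Union>K\<in>?S H j. ?T K)"
      unfolding split
    proof (rule card_Un_disjoint)
      show "finite (?S H (Suc j))" using finite_subspaces_between[OF H(1), of F] by simp
      show "finite (\<Union>K\<in>?S H j. ?T K)"
        by (rule finite_subset[of _ "Pow A"]) (use fin_subspaceD[OF \<open>fin_subspace A\<close>] in auto)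
    qed (auto simp: subspaces_between_def)
    also have "card (\<Union>K\<in>?S H j. ?T K) = (\<Sum>K\<in>?S H j. card (?T K))"
    proof (rule card_UN_disjoint)
      show "finite (?S H j)" using finite_subspaces_between[OF H(1), of F] by simp
      show "\<forall>K\<in>?S H j. finite (?T K)"
      proof
        fix K
        show "finite (?T K)"
          by (rule finite_subset[of _ "Pow A"]) (use fin_subspaceD[OF \<open>fin_subspace A\<close>] in auto)
      qed
    qed auto
    also have "\<dots> = (\<Sum>K\<in>?S H j. CARD('f) ^ (n - j))"
    proof (rule sum.cong)
      fix K assume K: "K \<in> ?S H j"
      then have "fin_subspace K" "K \<subseteq> H" "dim H - dim K = n - j"
        using subspaces_between_fin[OF H(1)] H by (auto simp: subspaces_between_def)
      then show "card (?T K) = CARD('f) ^ (n - j)"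
        using card_transversal_subspaces[OF \<open>fin_subspace A\<close> H(1,3) dH, of K] by simp
    qed simp
    finally show ?thesis using Suc IH[of "Suc j"] IH[of j]
      by (simp flip: \<open>Suc n = dim A - dim F\<close>)
  qed
qed

text \<open>The rank generating polynomial of an interval of subspaces. Its coefficients are
  Gaussian binomials, whose symmetry makes it palindromic.\<close>

definition interval_poly :: "'v set \<Rightarrow> 'v set \<Rightarrow> int poly" where
  "interval_poly F A = (\<Sum>G\<in>subspaces_between F A. monom 1 (dim G - dim F))"

lemma coeff_interval_poly:
  assumes A: "fin_subspace A" and F: "fin_subspace F" "F \<subseteq> A"
  shows "coeff (interval_poly F A) k = int (gauss CARD('f) (dim A - dim F) k)"
proof -
  have "dim F \<le> dim G" if "G \<in> subspaces_between F A" for G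
    using that dim_mono_fin[OF F(1)] subspaces_between_fin[OF A that]
    by (auto simp: subspaces_between_def)
  then have "{G\<in>subspaces_between F A. dim G - dim F = k} =
      {G\<in>subspaces_between F A. dim G = dim F + k}" by force
  moreover have "coeff (interval_poly F A) k = int (card {G\<in>subspaces_between F A. dim G - dim F = k})"
    using finite_subspaces_between[OF A, of F]
    by (simp add: interval_poly_def coeff_sum sum.If_cases Int_def eq_commute)
  ultimately show ?thesis using card_subspaces_between[OF assms] by simp
qed

lemma interval_poly_palindromic:
  assumes A: "fin_subspace A" and F: "fin_subspace F" "F \<subseteq> A"
  shows "degree (interval_poly F A) \<le> dim A - dim F"
    and "reverse_at (dim A - dim F) (interval_poly F A) = interval_poly F A"
proof -
  show *: "degree (interval_poly F A) \<le> dim A - dim F"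
    by (rule degree_le) (auto simp: coeff_interval_poly[OF assms] gauss_eq_0)
  show "reverse_at (dim A - dim F) (interval_poly F A) = interval_poly F A"
    by (rule poly_eqI)
      (simp add: coeff_reverse_at[OF *] coeff_interval_poly[OF assms] gauss_symmetric[OF q_gt_1] gauss_eq_0
        del: diff_diff_left)
qed

end

lemma reverse_at_diff:
  "degree p \<le> r \<Longrightarrow> degree q \<le> r \<Longrightarrow> reverse_at r (p - q) = reverse_at r p - reverse_at r q"
  by (rule poly_eqI) (auto simp: coeff_reverse_at degree_diff_le)

text \<open>If \<open>k = degree x\<close> exceeded \<open>m\<close>, coefficient \<open>k\<close>
  of the sum would be the leading coefficient of \<open>x\<close>. By symmetry it equals coefficient
  \<open>a - k\<close>, where both \<open>x\<close> and \<open>y\<close> vanish because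
  \<open>a - k > k\<close>.\<close>

lemma degree_le_of_palindromic_sum:
  assumes pal: "reverse_at a (x + y) = x + y" and "degree (x + y) \<le> a"
    and x: "2 * degree x < a" and y: "degree y \<le> m"
  shows "degree x \<le> m"
proof (rule ccontr)
  let ?k = "degree x"
  assume k: "\<not> ?k \<le> m"
  have "coeff (x + y) ?k = coeff (x + y) (a - ?k)"
    using coeff_reverse_at[OF assms(2), of ?k] x unfolding pal by simp
  moreover have "coeff x (a - ?k) = 0" using x by (intro coeff_eq_0) auto
  moreover have "coeff y (a - ?k) = 0" "coeff y ?k = 0" using x y k by (auto intro!: coeff_eq_0)
  ultimately have "lead_coeff x = 0" by simp
  then show False using k by simp
qed

section \<open>Point matroids\<close>

context finite_field_space
begin

lemma ground_point_matroid [simp]: "ground (local.point_matroid E) = E"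
  and rk_point_matroid [simp]: "rk (local.point_matroid E) A = dim (local.point_span A)"
  and mrestrict_point_matroid [simp]: "mrestrict (local.point_matroid E) F = local.point_matroid F"
  by (simp_all add: point_matroid_def mrestrict_def)

lemma proj_pointsE:
  assumes "L \<in> local.proj_points U"
  obtains v where "v \<in> U" "v \<noteq> 0" "L = span {v}"
proof -
  from assms have L: "subspace L" "L \<subseteq> U" "dim L = 1" by (auto simp: proj_points_def)
  obtain B where B: "B \<subseteq> L" "independent B" "L \<subseteq> span B" "card B = 1"
    using basis_exists[of L] L by metis
  then obtain v where v: "B = {v}" by (auto simp: card_1_singleton_iff)
  then have "v \<noteq> 0" "L = span {v}" using B L span_minimal[of B L] by (auto simp: dependent_single)
  then show ?thesis using that[of v] B v L by auto
qed

lemma span_singleton_in_proj_points: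
  assumes "subspace U" "v \<noteq> 0"
  shows "span {v} \<in> local.proj_points U \<longleftrightarrow> v \<in> U"
proof
  assume "span {v} \<in> local.proj_points U"
  then show "v \<in> U" using span_base[of v "{v}"] by (auto simp: proj_points_def)
next
  assume "v \<in> U"
  then have "span {v} \<subseteq> U" using assms by (intro span_minimal) auto
  moreover have "dim (span {v}) = 1"
    using assms dim_span_eq_card_independent[of "{v}"] by (simp add: dependent_single)
  ultimately show "span {v} \<in> local.proj_points U" by (simp add: proj_points_def)
qed

lemma finite_proj_points: "fin_subspace V \<Longrightarrow> finite (local.proj_points V)"
  by (rule finite_subset[of _ "Pow V"]) (auto simp: proj_points_def fin_subspace_def)

lemma proj_points_mono: "U \<subseteq> T \<Longrightarrow> local.proj_points U \<subseteq> local.proj_points T"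
  by (auto simp: proj_points_def)

lemma subspace_point_span [simp]: "subspace (local.point_span E)"
  by (simp add: point_span_def)

lemma point_span_empty [simp]: "local.point_span {} = {0}"
  by (simp add: point_span_def)

lemma point_span_mono: "E \<subseteq> E' \<Longrightarrow> local.point_span E \<subseteq> local.point_span E'"
  unfolding point_span_def by (intro span_mono) auto

lemma point_span_subset_iff: "subspace G \<Longrightarrow> local.point_span E \<subseteq> G \<longleftrightarrow> (\<forall>L\<in>E. L \<subseteq> G)"
  unfolding point_span_def using span_minimal[of "\<Union>E" G] span_superset[of "\<Union>E"] by blast

lemma point_span_subset:
  "subspace G \<Longrightarrow> E \<subseteq> local.proj_points G \<Longrightarrow> local.point_span E \<subseteq> G"
  by (auto simp: point_span_subset_iff proj_points_def)

lemma fin_subspace_point_span: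
  "fin_subspace V \<Longrightarrow> E \<subseteq> local.proj_points V \<Longrightarrow> fin_subspace (local.point_span E)"
  using fin_subspace_subset[of V "local.point_span E"] point_span_subset[of V E]
  by (simp add: fin_subspaceD)

lemma dim_point_span_le_card:
  assumes "A \<subseteq> local.proj_points V" "finite A"
  shows "dim (local.point_span A) \<le> card A"
proof -
  have "\<forall>L\<in>A. \<exists>v. L = span {v}" using assms(1) proj_pointsE by (metis subsetD)
  then obtain v where v: "\<And>L. L \<in> A \<Longrightarrow> L = span {v L}" by metis
  have "L \<subseteq> span (v ` A)" if "L \<in> A" for L
    using v[OF that] that span_mono[of "{v L}" "v ` A"] by auto
  then have "\<Union>A \<subseteq> span (v ` A)" by blast
  then have "dim (\<Union>A) \<le> card (v ` A)" using assms by (intro dim_le_card) auto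
  also have "\<dots> \<le> card A" using assms by (intro card_image_le)
  finally show ?thesis by (simp add: point_span_def)
qed

lemma loopless_matroid_point_matroid:
  assumes V: "fin_subspace V" and E: "E \<subseteq> local.proj_points V"
  shows "loopless_matroid (local.point_matroid E)"
  unfolding loopless_matroid_def is_matroid_def
proof (intro conjI allI impI)
  have fin: "finite E" using E finite_proj_points[OF V] by (rule finite_subset)
  then show "finite (ground (local.point_matroid E))" by simp
  have fs: "fin_subspace (local.point_span A)" if "A \<subseteq> E" for A
    using that E by (intro fin_subspace_point_span[OF V]) auto
  show "rk (local.point_matroid E) A \<le> card A" if "A \<subseteq> ground (local.point_matroid E)" for A
    using that E fin dim_point_span_le_card[of A V] finite_subset[of A E] by auto
  show "rk (local.point_matroid E) A \<le> rk (local.point_matroid E) B"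
    if "A \<subseteq> B" "B \<subseteq> ground (local.point_matroid E)" for A B
    using that fs[of A] fs[of B] point_span_mono[of A B] by (simp add: dim_mono_fin)
  show "rk (local.point_matroid E) (A \<union> B) + rk (local.point_matroid E) (A \<inter> B)
      \<le> rk (local.point_matroid E) A + rk (local.point_matroid E) B"
    if "A \<subseteq> ground (local.point_matroid E)" "B \<subseteq> ground (local.point_matroid E)" for A B
  proof -
    let ?A = "local.point_span A" and ?B = "local.point_span B"
    have AB: "fin_subspace ?A" "fin_subspace ?B" using that fs by auto
    \<comment> \<open>Submodularity of the rank comes from the modular law for dimensions, with the
      span of the common points possibly smaller than the intersection of the spans.\<close>
    have "local.point_span (A \<union> B) \<subseteq> span (?A \<union> ?B)"
      unfolding point_span_def
      by (intro span_minimal) (auto intro: span_base)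
    then have 1: "dim (local.point_span (A \<union> B)) \<le> dim (span (?A \<union> ?B))"
      using that fs AB by (intro dim_mono_fin fin_subspace_span) (auto simp: fin_subspaceD)
    have "local.point_span (A \<inter> B) \<subseteq> ?A \<inter> ?B"
      using point_span_mono[of "A \<inter> B" A] point_span_mono[of "A \<inter> B" B] by auto
    then have 2: "dim (local.point_span (A \<inter> B)) \<le> dim (?A \<inter> ?B)"
      using AB by (intro dim_mono_fin fin_subspace_Int fs) (use that in \<open>auto simp: fin_subspaceD\<close>)
    show ?thesis using 1 2 dim_sum_Int[OF AB] by (simp del: dim_span)
  qed
  show "loopless (local.point_matroid E)"
    using E by (auto simp: loopless_def point_span_def proj_points_def subset_eq)
qed

definition points_in :: "'v set set \<Rightarrow> 'v set \<Rightarrow> 'v set set" where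
  "points_in E G = {L\<in>E. L \<subseteq> G}"

lemma points_in_subset: "points_in E G \<subseteq> E"
  by (auto simp: points_in_def)

lemma point_span_points_in_subset: "subspace G \<Longrightarrow> local.point_span (points_in E G) \<subseteq> G"
  by (simp add: point_span_subset_iff points_in_def)

lemma in_point_span_points_in:
  assumes "subspace G" "v \<in> G" "span {v} \<in> E"
  shows "v \<in> local.point_span (points_in E G)"
proof -
  have "span {v} \<subseteq> G" using assms by (intro span_minimal) auto
  then have "v \<in> \<Union>(points_in E G)" using assms span_base[of v "{v}"] by (auto simp: points_in_def)
  then show ?thesis unfolding point_span_def by (rule span_base)
qed

text \<open>The points of \<open>E\<close> in \<open>G\<close> span a subspace of \<open>G\<close>,
  so any further point of \<open>E\<close>, not being contained in \<open>G\<close>, enlarges that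
  span.\<close>

lemma points_in_flat:
  assumes V: "fin_subspace V" and E: "E \<subseteq> local.proj_points V" and G: "subspace G"
  shows "points_in E G \<in> flats (local.point_matroid E)"
  unfolding flats_def
proof (intro CollectI conjI ballI)
  let ?P = "points_in E G"
  fix L assume "L \<in> ground (local.point_matroid E) - ?P"
  then have L: "L \<in> E" "\<not> L \<subseteq> G" by (auto simp: points_in_def)
  have sub: "?P \<subseteq> local.proj_points V" "insert L ?P \<subseteq> local.proj_points V"
    using E L points_in_subset[of E G] by auto
  have "local.point_span ?P \<subset> local.point_span (insert L ?P)"
  proof
    show "local.point_span ?P \<subseteq> local.point_span (insert L ?P)" by (rule point_span_mono) auto
    have "L \<subseteq> local.point_span (insert L ?P)"
      using point_span_subset_iff[of "local.point_span (insert L ?P)" "insert L ?P"] by simp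
    then show "local.point_span ?P \<noteq> local.point_span (insert L ?P)"
      using L point_span_points_in_subset[OF G, of E] by auto
  qed
  then show "rk (local.point_matroid E) ?P < rk (local.point_matroid E) (insert L ?P)"
    using sub by (simp add: dim_strict_mono_fin fin_subspace_point_span[OF V])
qed (simp add: points_in_def)

lemma flats_points_in:
  assumes V: "fin_subspace V" and E: "E \<subseteq> local.proj_points V" and G: "subspace G"
  shows "flats (local.point_matroid (points_in E G)) =
    {F\<in>flats (local.point_matroid E). local.point_span F \<subseteq> G}"
proof -
  have "is_matroid (local.point_matroid E)"
    using loopless_matroid_point_matroid[OF V E] by (simp add: loopless_matroid_def)
  from flats_mrestrict[OF this points_in_flat[OF assms]] show ?thesis
    using flats_subset[of _ "local.point_matroid E"]
    by (auto simp: point_span_subset_iff[OF G] points_in_def)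
qed

text \<open>
  The row of the inverse Kazhdan-Lusztig matrix of \<open>E\<close>, extended from the subspaces spanned by
  points of \<open>E\<close> to all subspaces.
\<close>

definition weight :: "'v set set \<Rightarrow> 'v set \<Rightarrow> int poly" where
  "weight E G = monom 1 (dim G - dim (local.point_span (points_in E G))) *
     signed inverse_KL_poly (local.point_matroid (points_in E G))"

lemma degree_signed_inverse_KL_point_matroid:
  assumes V: "fin_subspace V" and E: "E \<subseteq> local.proj_points V"
  shows "2 * degree (inverse_KL_poly (local.point_matroid E)) \<le> dim (local.point_span E)"
    and "dim (local.point_span E) > 0 \<Longrightarrow>
      2 * degree (inverse_KL_poly (local.point_matroid E)) < dim (local.point_span E)"
  using inverse_KL_degree_le[OF loopless_matroid_point_matroid[OF assms]]
    inverse_KL_degree[OF loopless_matroid_point_matroid[OF assms]] by auto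

lemma degree_weight_le_add:
  "degree (weight E G) \<le> (dim G - dim (local.point_span (points_in E G))) +
     degree (inverse_KL_poly (local.point_matroid (points_in E G)))"
  unfolding weight_def by (rule order_trans[OF degree_mult_le]) (simp add: degree_monom_le)

lemma degree_weight_le:
  assumes V: "fin_subspace V" and E: "E \<subseteq> local.proj_points V" and G: "subspace G" "G \<subseteq> V"
  shows "degree (weight E G) \<le> dim G"
proof -
  have P: "points_in E G \<subseteq> local.proj_points V" using E points_in_subset[of E G] by auto
  have "fin_subspace G" using fin_subspace_subset V G by blast
  then have "dim (local.point_span (points_in E G)) \<le> dim G"
    using point_span_points_in_subset[OF G(1)] fin_subspace_point_span[OF V P] by (simp add: dim_mono_fin)
  then show ?thesis
    using degree_weight_le_add[of E G] degree_signed_inverse_KL_point_matroid(1)[OF V P] by linarith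
qed

text \<open>When the points of \<open>E\<close> in \<open>G\<close> span \<open>G\<close>, the extra
  power of \<open>t\<close> is 1, so the strict degree bound of the inverse polynomial applies
  unchanged.\<close>

lemma degree_weight_spanned:
  assumes V: "fin_subspace V" and E: "E \<subseteq> local.proj_points V"
    and G: "local.point_span (points_in E G) = G" "dim G > 0"
  shows "2 * degree (weight E G) < dim G"
proof -
  have P: "points_in E G \<subseteq> local.proj_points V" using E points_in_subset[of E G] by auto
  show ?thesis
    using degree_weight_le_add[of E G] degree_signed_inverse_KL_point_matroid(2)[OF V P] G by simp
qed

text \<open>The power of \<open>t\<close> in \<open>weight\<close> merges with the powers from
  \<open>tau_fun\<close>. The result has the same form for every \<open>G\<close>, spanned or not,
  which is the reason for extending to all subspaces in this way.\<close>

lemma weight_expand: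
  assumes V: "fin_subspace V" and E: "E \<subseteq> local.proj_points V" and G: "subspace G" "G \<subseteq> V"
  shows "weight E G = (\<Sum>F\<in>{F\<in>flats (local.point_matroid E). local.point_span F \<subseteq> G}.
    Z_inverse (local.point_matroid F) * monom 1 (dim G - dim (local.point_span F)))"
proof -
  let ?P = "points_in E G" let ?N = "local.point_matroid ?P"
  have P: "?P \<subseteq> local.proj_points V" using E points_in_subset[of E G] by auto
  note N = loopless_matroid_point_matroid[OF V P]
  have PG: "dim (local.point_span ?P) \<le> dim G"
    using point_span_points_in_subset[OF G(1)] fin_subspace_point_span[OF V P]
      fin_subspace_subset[OF V G] by (simp add: dim_mono_fin)
  have "weight E G = (\<Sum>F\<in>flats ?N. monom 1 (dim G - dim (local.point_span ?P)) *
      (Z_inverse (mrestrict ?N F) * tau_fun (mcontract ?N F)))"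
    unfolding weight_def signed_inverse_KL_eq[OF N] conv_def by (simp add: sum_distrib_left)
  also have "\<dots> = (\<Sum>F\<in>flats ?N.
      Z_inverse (local.point_matroid F) * monom 1 (dim G - dim (local.point_span F)))"
  proof (rule sum.cong)
    fix F assume F: "F \<in> flats ?N"
    have le: "dim (local.point_span F) \<le> dim (local.point_span ?P)"
      using flat_rk_le_mrank[OF N F] by simp
    have "tau_fun (mcontract ?N F) = monom 1 (dim (local.point_span ?P) - dim (local.point_span F))"
      unfolding tau_fun_def mrank_mcontract[OF N F] by simp
    then show "monom 1 (dim G - dim (local.point_span ?P)) *
        (Z_inverse (mrestrict ?N F) * tau_fun (mcontract ?N F)) =
        Z_inverse (local.point_matroid F) * monom 1 (dim G - dim (local.point_span F))"
      using le PG by (simp add: mult.left_commute mult_monom)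
  qed simp
  finally show ?thesis unfolding flats_points_in[OF V E G(1)] .
qed

text \<open>The degree bound keeps the sums within the range where \<open>reverse_at\<close> is
  additive, so that the property passes to differences.\<close>

definition palindromic_sums :: "'v set \<Rightarrow> ('v set \<Rightarrow> int poly) \<Rightarrow> bool" where
  "palindromic_sums V f \<longleftrightarrow> (\<forall>A. subspace A \<longrightarrow> A \<subseteq> V \<longrightarrow> degree (f A) \<le> dim A \<and>
     reverse_at (dim A) (\<Sum>G\<in>subspaces_between {} A. f G) = (\<Sum>G\<in>subspaces_between {} A. f G))"

lemma degree_sum_subspaces:
  assumes V: "fin_subspace V" and f: "palindromic_sums V f" and A: "subspace A" "A \<subseteq> V"
  shows "degree (\<Sum>G\<in>subspaces_between {} A. f G) \<le> dim A"
proof (rule degree_sum_le)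
  have finA: "fin_subspace A" using fin_subspace_subset V A by blast
  then show "finite (subspaces_between {} A)" by (rule finite_subspaces_between)
  fix G assume G: "G \<in> subspaces_between {} A"
  then have "degree (f G) \<le> dim G" using f A by (auto simp: palindromic_sums_def subspaces_between_def)
  also have "\<dots> \<le> dim A"
    using G finA subspaces_between_fin[OF finA G] by (auto simp: subspaces_between_def intro: dim_mono_fin)
  finally show "degree (f G) \<le> dim A" .
qed

lemma palindromic_sums_diff:
  assumes V: "fin_subspace V" and f: "palindromic_sums V f" and g: "palindromic_sums V g"
  shows "palindromic_sums V (\<lambda>G. f G - g G)"
  using f g degree_sum_subspaces[OF V f] degree_sum_subspaces[OF V g]
  unfolding palindromic_sums_def[of V "\<lambda>G. f G - g G"]
  by (auto simp: sum_subtractf reverse_at_diff degree_diff_le palindromic_sums_def)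

text \<open>The inductive step of all degree estimates: the term at \<open>A\<close> is separated
  from the sum over its proper subspaces, which has degree at most \<open>m\<close>.\<close>

lemma palindromic_sums_degree_le:
  assumes V: "fin_subspace V" and f: "palindromic_sums V f" and A: "subspace A" "A \<subseteq> V"
    and deg: "2 * degree (f A) < dim A"
    and m: "\<And>G. subspace G \<Longrightarrow> G \<subset> A \<Longrightarrow> degree (f G) \<le> m"
  shows "degree (f A) \<le> m"
proof -
  let ?S = "subspaces_between {} A"
  have fin: "finite ?S" using finite_subspaces_between fin_subspace_subset V A by blast
  have "(\<Sum>G\<in>?S. f G) = f A + (\<Sum>G\<in>?S - {A}. f G)"
    using fin A by (intro sum.remove) (auto simp: subspaces_between_def)
  moreover have "reverse_at (dim A) (\<Sum>G\<in>?S. f G) = (\<Sum>G\<in>?S. f G)"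
    using f A by (simp add: palindromic_sums_def)
  moreover have "degree (\<Sum>G\<in>?S - {A}. f G) \<le> m"
    using fin m by (intro degree_sum_le) (auto simp: subspaces_between_def psubset_eq)
  ultimately show ?thesis
    using degree_le_of_palindromic_sum[of "dim A" "f A" "\<Sum>G\<in>?S - {A}. f G" m]
      degree_sum_subspaces[OF V f A] deg by simp
qed

text \<open>After exchanging the sums, each flat \<open>F\<close> contributes
  \<open>Z_inverse\<close> times the polynomial of the interval from its span to \<open>A\<close>.
  Both factors are palindromic, and their centres add up to \<open>dim A / 2\<close>.\<close>

lemma palindromic_sums_weight:
  assumes V: "fin_subspace V" and E: "E \<subseteq> local.proj_points V"
  shows "palindromic_sums V (weight E)"
  unfolding palindromic_sums_def
proof (intro allI impI conjI)
  fix A assume A: "subspace A" "A \<subseteq> V"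
  show "degree (weight E A) \<le> dim A" by (rule degree_weight_le[OF V E A])
  let ?L = "flats (local.point_matroid E)" let ?r = "\<lambda>F. dim (local.point_span F)"
  have finA: "fin_subspace A" using fin_subspace_subset V A by blast
  note M = loopless_matroid_point_matroid[OF V E]
  have finL: "finite ?L" using finite_flats M by (auto simp: loopless_matroid_def)
  have "(\<Sum>G\<in>subspaces_between {} A. weight E G) =
    (\<Sum>G\<in>subspaces_between {} A. \<Sum>F\<in>{F\<in>?L. local.point_span F \<subseteq> G}.
      Z_inverse (local.point_matroid F) * monom 1 (dim G - ?r F))"
    using A by (intro sum.cong weight_expand[OF V E]) (auto simp: subspaces_between_def)
  also have "\<dots> = (\<Sum>F\<in>?L. \<Sum>G\<in>{G\<in>subspaces_between {} A. local.point_span F \<subseteq> G}.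
      Z_inverse (local.point_matroid F) * monom 1 (dim G - ?r F))"
    by (intro sum.swap_restrict finite_subspaces_between finA finL)
  also have "\<dots> = (\<Sum>F\<in>?L. Z_inverse (local.point_matroid F) *
      interval_poly (local.point_span F) A)"
    by (intro sum.cong refl) (auto simp: interval_poly_def sum_distrib_left subspaces_between_def
        intro!: sum.cong)
  \<comment> \<open>Flats whose span leaves \<open>A\<close> have an empty interval, hence a zero
    interval polynomial.\<close>
  also have "\<dots> = (\<Sum>F\<in>{F\<in>?L. local.point_span F \<subseteq> A}. Z_inverse (local.point_matroid F) *
      interval_poly (local.point_span F) A)"
  proof (rule sum.mono_neutral_right[OF finL])
    show "\<forall>F\<in>?L - {F\<in>?L. local.point_span F \<subseteq> A}.
        Z_inverse (local.point_matroid F) * interval_poly (local.point_span F) A = 0"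
    proof
      fix F assume "F \<in> ?L - {F\<in>?L. local.point_span F \<subseteq> A}"
      then have "subspaces_between (local.point_span F) A = {}"
        by (auto simp: subspaces_between_def)
      then show "Z_inverse (local.point_matroid F) * interval_poly (local.point_span F) A = 0"
        by (simp add: interval_poly_def)
    qed
  qed auto
  finally have eq: "(\<Sum>G\<in>subspaces_between {} A. weight E G) =
    (\<Sum>F\<in>{F\<in>?L. local.point_span F \<subseteq> A}. Z_inverse (local.point_matroid F) *
      interval_poly (local.point_span F) A)" .
  have summand: "degree (Z_inverse (local.point_matroid F) * interval_poly (local.point_span F) A) \<le> dim A
      \<and> reverse_at (dim A) (Z_inverse (local.point_matroid F) * interval_poly (local.point_span F) A)
        = Z_inverse (local.point_matroid F) * interval_poly (local.point_span F) A"
    if F: "F \<in> ?L" "local.point_span F \<subseteq> A" for F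
  proof -
    have FE: "F \<subseteq> local.proj_points V" using flats_subset[OF F(1)] E by auto
    note finF = fin_subspace_point_span[OF V FE]
    note N = loopless_matroid_point_matroid[OF V FE]
    have Z: "degree (Z_inverse (local.point_matroid F)) \<le> ?r F"
      "reverse_at (?r F) (Z_inverse (local.point_matroid F)) = Z_inverse (local.point_matroid F)"
      using gradedD[OF graded_Z_inverse N] reversed_Z_inverse[OF N] by (simp_all add: reversed_def)
    note I = interval_poly_palindromic[OF finA finF F(2)]
    have "dim A = ?r F + (dim A - ?r F)" using dim_mono_fin[OF finF finA F(2)] by simp
    then show ?thesis
      using reverse_at_mult[OF Z(1) I(1)] Z(2) I(2) add_mono[OF Z(1) I(1)]
        degree_mult_le[of "Z_inverse (local.point_matroid F)" "interval_poly (local.point_span F) A"]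
      by simp
  qed
  show "reverse_at (dim A) (\<Sum>G\<in>subspaces_between {} A. weight E G) =
      (\<Sum>G\<in>subspaces_between {} A. weight E G)"
    unfolding eq using summand by (subst reverse_at_sum) auto
qed

end

section \<open>Weights for the points outside a subspace\<close>

context finite_field_space
begin

lemma fin_subspace_of_fin_dim: "local.fin_dim_subspace V \<Longrightarrow> fin_subspace V"
  by (auto simp: fin_dim_subspace_def fin_subspace_def finite_span)

lemma points_in_proj_points:
  "subspace V \<Longrightarrow> E \<subseteq> local.proj_points V \<Longrightarrow> points_in E V = E"
  by (auto simp: points_in_def proj_points_def)

lemma weight_top:
  assumes "subspace V" "E \<subseteq> local.proj_points V" "local.point_span E = V"
  shows "weight E V = (-1) ^ dim V * inverse_KL_poly (local.point_matroid E)"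
  using assms by (simp add: weight_def points_in_proj_points signed_def)

lemma dim_zero [simp]: "dim {0} = 0"
  using dim_span_eq_card_independent[OF independent_empty] unfolding span_empty by simp

lemma weight_no_points:
  assumes "points_in E G = {}" shows "weight E G = monom 1 (dim G)"
  using assms inverse_KL_rank_0[of "local.point_matroid {}"]
  by (simp add: weight_def signed_def)

lemma points_in_complement_eq_empty_iff:
  assumes "subspace W" "G \<subseteq> W"
  shows "points_in (local.proj_points V - local.proj_points W - S) G = {}"
  using assms by (auto simp: points_in_def proj_points_def)

lemma complement_subset_point_span:
  assumes "subspace V" "subspace W" "subspace G" "G \<subseteq> V" "v \<in> G" "v \<notin> W" "span {v} \<notin> S"
  shows "v \<in> local.point_span (points_in (local.proj_points V - local.proj_points W - S) G)"
proof -
  have "v \<noteq> 0" using assms subspace_0 by blast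
  then show ?thesis
    using assms by (intro in_point_span_points_in) (auto simp: span_singleton_in_proj_points)
qed

lemma point_span_complement:
  assumes V: "subspace V" and W: "subspace W" and G: "subspace G" "G \<subseteq> V" "\<not> G \<subseteq> W"
  shows "local.point_span (points_in (local.proj_points V - local.proj_points W) G) = G"
proof
  let ?P = "local.point_span (points_in (local.proj_points V - local.proj_points W) G)"
  show "?P \<subseteq> G" by (rule point_span_points_in_subset[OF G(1)])
  have "G - W \<subseteq> ?P" using complement_subset_point_span[OF V W G(1,2), of _ "{}"] by auto
  then have "span (G - W) \<subseteq> ?P" by (intro span_minimal) auto
  then show "G \<subseteq> ?P" using span_complement[OF G(1) W G(3)] by simp
qed

lemma dim_pos: "fin_subspace G \<Longrightarrow> x \<in> G \<Longrightarrow> x \<noteq> 0 \<Longrightarrow> dim G > 0"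
  using dim_strict_mono_fin[of "{0}" G] fin_subspace_span[of "{}"] subspace_0[of G]
  by (auto simp: fin_subspaceD)

lemma degree_weight_complement_spanned:
  assumes V: "fin_subspace V" and W: "subspace W" and G: "subspace G" "G \<subseteq> V" "\<not> G \<subseteq> W"
  shows "2 * degree (weight (local.proj_points V - local.proj_points W) G) < dim G"
proof (rule degree_weight_spanned[OF V])
  show "local.point_span (points_in (local.proj_points V - local.proj_points W) G) = G"
    using point_span_complement[OF fin_subspaceD(1)[OF V] W G] .
  obtain g where "g \<in> G" "g \<notin> W" using G by auto
  then show "dim G > 0"
    using dim_pos[of G g] fin_subspace_subset[OF V G(1,2)] subspace_0[OF W] by auto
qed auto

text \<open>For \<open>G \<subseteq> W\<close> the general bound \<open>dim G\<close> suffices.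
  Otherwise \<open>G\<close> is spanned by its points outside \<open>W\<close>, and palindromicity
  reduces the bound to proper subspaces.\<close>

lemma degree_weight_complement:
  assumes V: "fin_subspace V" and W: "subspace W" and G: "subspace G" "G \<subseteq> V"
  shows "degree (weight (local.proj_points V - local.proj_points W) G) \<le> dim (G \<inter> W)"
  using G
proof (induction "dim G" arbitrary: G rule: less_induct)
  case less
  let ?B = "local.proj_points V - local.proj_points W"
  have finG: "fin_subspace G" using fin_subspace_subset[OF V] less.prems by blast
  show ?case
  proof (cases "G \<subseteq> W")
    case True
    then show ?thesis using degree_weight_le[OF V, of ?B G] less.prems by (simp add: Int_absorb2)
  next
    case False
    show ?thesis
    proof (rule palindromic_sums_degree_le[OF V palindromic_sums_weight[OF V]])
      show "2 * degree (weight ?B G) < dim G"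
        by (rule degree_weight_complement_spanned[OF V W less.prems False])
      fix H assume H: "subspace H" "H \<subset> G"
      then have finH: "fin_subspace H" using fin_subspace_subset[OF finG] by blast
      have "degree (weight ?B H) \<le> dim (H \<inter> W)"
        using H less.prems dim_strict_mono_fin[OF finH finG] by (intro less.hyps) auto
      also have "\<dots> \<le> dim (G \<inter> W)"
        using H finH finG W by (intro dim_mono_fin fin_subspace_Int) auto
      finally show "degree (weight ?B H) \<le> dim (G \<inter> W)" .
    qed (use less.prems in auto)
  qed
qed

text \<open>Write \<open>b = dim W\<close>. The sum over all subspaces has degree at most
  \<open>b\<close> but is symmetric under exchanging the exponents \<open>b\<close> and
  \<open>b + 1\<close>, so its coefficient at \<open>b\<close> vanishes. Only \<open>V\<close> and
  \<open>W\<close> contribute there, and \<open>W\<close> contributes 1.\<close>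

lemma coeff_weight_complement:
  assumes V: "fin_subspace V" and W: "subspace W" "W \<subseteq> V" and dim: "dim V = Suc (2 * dim W)"
  shows "coeff (weight (local.proj_points V - local.proj_points W) V) (dim W) = -1"
proof -
  let ?B = "local.proj_points V - local.proj_points W" let ?b = "dim W"
  let ?S = "subspaces_between {} V"
  let ?p = "\<Sum>G\<in>?S. weight ?B G"
  have subV: "subspace V" using V by (rule fin_subspaceD)
  have finW: "fin_subspace W" using fin_subspace_subset[OF V] W by blast
  have ne: "W \<noteq> V" using dim by auto
  have fin: "finite ?S" by (rule finite_subspaces_between[OF V])
  have pal: "palindromic_sums V (weight ?B)" by (rule palindromic_sums_weight[OF V]) auto
  have deg: "degree (weight ?B G) \<le> ?b" if G: "G \<in> ?S" for G
  proof -
    have "degree (weight ?B G) \<le> dim (G \<inter> W)"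
      using G by (intro degree_weight_complement[OF V W(1)]) (auto simp: subspaces_between_def)
    also have "\<dots> \<le> ?b"
      using subspaces_between_fin[OF V G] W finW by (intro dim_mono_fin fin_subspace_Int) auto
    finally show ?thesis .
  qed
  have "degree ?p \<le> ?b" by (intro degree_sum_le fin deg)
  then have "coeff ?p (Suc ?b) = 0" by (intro coeff_eq_0) simp
  moreover have "reverse_at (dim V) ?p = ?p" using pal subV by (simp add: palindromic_sums_def)
  then have "coeff ?p ?b = coeff ?p (dim V - ?b)"
    using coeff_reverse_at[OF degree_sum_subspaces[OF V pal subV order_refl], of ?b] dim by simp
  ultimately have "coeff ?p ?b = 0" using dim by simp
  moreover have "?p = weight ?B V + (weight ?B W + (\<Sum>G\<in>?S - {V} - {W}. weight ?B G))"
  proof -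
    have "?p = weight ?B V + (\<Sum>G\<in>?S - {V}. weight ?B G)"
      using fin subV by (intro sum.remove) (auto simp: subspaces_between_def)
    also have "(\<Sum>G\<in>?S - {V}. weight ?B G) = weight ?B W + (\<Sum>G\<in>?S - {V} - {W}. weight ?B G)"
      using fin W ne by (intro sum.remove) (auto simp: subspaces_between_def)
    finally show ?thesis .
  qed
  moreover have "coeff (weight ?B W) ?b = 1"
    using weight_no_points[OF points_in_complement_eq_empty_iff[OF W(1) order_refl, of V "{}"]]
    by simp
  \<comment> \<open>Proper subspaces of \<open>W\<close> have too small a dimension. A proper
    subspace of \<open>V\<close> not inside \<open>W\<close> has dimension at most
    \<open>2 * ?b\<close>, and its weight has degree strictly below half of that dimension.\<close>
  moreover have "coeff (weight ?B G) ?b = 0" if "G \<in> ?S - {V} - {W}" for G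
  proof (rule coeff_eq_0)
    have G: "subspace G" "G \<subseteq> V" "G \<noteq> V" "G \<noteq> W" using that by (auto simp: subspaces_between_def)
    have finG: "fin_subspace G" using fin_subspace_subset[OF V] G by blast
    show "degree (weight ?B G) < ?b"
    proof (cases "G \<subseteq> W")
      case True
      then have "dim G < ?b" using dim_strict_mono_fin[OF finG finW] G by auto
      then show ?thesis using degree_weight_le[OF V, of ?B G] G by auto
    next
      case False
      have "dim G < dim V" using dim_strict_mono_fin[OF finG V] G by auto
      then show ?thesis using degree_weight_complement_spanned[OF V W(1) G(1,2) False] dim by linarith
    qed
  qed
  ultimately show ?thesis by (simp add: coeff_sum)
qed

end

section \<open>Deleting points outside a hyperplane\<close>

locale deletion = finite_field_space scale
  for scale :: "'f::{field,finite} \<Rightarrow> 'v::ab_group_add \<Rightarrow> 'v" (infixr \<open>*s\<close> 75) +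
  fixes V W Y X :: "'v set" and S :: "'v set set"
  assumes deletion: "local.deletion_setup V W Y X S"
begin

definition B :: "'v set set" where "B = local.proj_points V - local.proj_points W"
definition M :: "'v set set" where "M = B - S"

lemma finV: "fin_subspace V"
  using deletion fin_subspace_of_fin_dim by (auto simp: deletion_setup_def)

lemma sub: "subspace V" "subspace W" "subspace Y" "subspace X"
  and incl: "W \<subset> V" "Y \<subseteq> V" "X \<subseteq> Y"
  and S: "S \<subseteq> local.proj_points Y - local.proj_points X - local.proj_points W"
  using deletion fin_subspaceD[OF finV] by (auto simp: deletion_setup_def)

lemma M_spans: "local.point_span M = V"
  using deletion by (simp add: deletion_setup_def M_def B_def)

lemma fin: "fin_subspace W" "fin_subspace Y" "fin_subspace X"
  using fin_subspace_subset[OF finV] sub incl by blast+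

lemma subset_points: "B \<subseteq> local.proj_points V" "M \<subseteq> local.proj_points V"
  by (auto simp: B_def M_def)

lemma decompose:
  assumes "y \<in> Y" "y \<notin> X" "z \<in> Y" shows "\<exists>c. z - c *s y \<in> X"
  using deletion by (intro hyperplane_decompose[OF fin(3,2) incl(3) _ assms]) (simp add: deletion_setup_def)

text \<open>A vector of \<open>G\<close> outside \<open>W\<close> spans a point of \<open>B\<close>.
  If that point does not help to span \<open>G\<close>, it was deleted, and all deleted points lie
  in \<open>Y\<close> but not in \<open>X\<close>.\<close>

lemma outside_point_span:
  assumes G: "subspace G" "G \<subseteq> V" and v: "v \<in> G" "v \<notin> W" "v \<notin> local.point_span (points_in M G)"
  shows "v \<in> Y" "v \<notin> X"
proof -
  have "span {v} \<in> S"
    using complement_subset_point_span[OF sub(1,2) G v(1,2), of S] v(3) by (auto simp: M_def B_def)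
  moreover have "v \<noteq> 0" using v(2) subspace_0[OF sub(2)] by auto
  ultimately show "v \<in> Y" "v \<notin> X"
    using S span_singleton_in_proj_points sub(3,4) by (blast, blast)
qed

text \<open>Let \<open>G'\<close> be the span of the points of \<open>M\<close> in \<open>G\<close>.
  If \<open>G \<subseteq> Y\<close>, then \<open>X\<close> cuts \<open>G\<close> in codimension at
  most one. If not, the vectors outside \<open>W\<close> and \<open>G'\<close>, all confined to
  \<open>Y - X\<close>, force \<open>dim G' \<le> ?l + 1\<close> and
  \<open>dim G \<le> ?l + 2\<close>.\<close>

lemma degree_weight_unspanned:
  assumes G: "subspace G" "G \<subseteq> V" "\<not> G \<subseteq> W" and ne: "local.point_span (points_in M G) \<noteq> G"
  shows "degree (weight M G) \<le> dim (G \<inter> W \<inter> X) + 1"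
    and "degree (weight B G) \<le> dim (G \<inter> W \<inter> X) + 1"
proof -
  define G' where "G' = local.point_span (points_in M G)"
  let ?l = "dim (G \<inter> W \<inter> X)"
  have finG: "fin_subspace G" using fin_subspace_subset[OF finV] G by blast
  have sub': "subspace G'" by (simp add: G'_def)
  have G'G: "G' \<subseteq> G" unfolding G'_def by (rule point_span_points_in_subset[OF G(1)])
  have finG': "fin_subspace G'" using fin_subspace_subset[OF finG sub' G'G] .
  have nG: "\<not> G \<subseteq> G'" using ne G'G by (auto simp: G'_def)
  have out: "v \<in> Y" "v \<notin> X" if "v \<in> G" "v \<notin> W" "v \<notin> G'" for v
    using outside_point_span[OF G(1,2)] that unfolding G'_def by blast+
  have mono: "dim T \<le> dim T'" if "T \<subseteq> T'" "T' \<subseteq> V" "subspace T" "subspace T'" for T T'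
    using that fin_subspace_subset[OF finV] by (intro dim_mono_fin) auto
  obtain g where g: "g \<in> G" "g \<notin> W" "g \<notin> G'"
    using subspace_not_subset_Un[OF G(1) sub(2) sub' G(3) nG] .
  note gY = out[OF g]
  have add_notin: "subspace T \<Longrightarrow> x \<in> T \<Longrightarrow> y \<notin> T \<Longrightarrow> x + y \<notin> T"
    "subspace T \<Longrightarrow> x \<in> T \<Longrightarrow> y \<notin> T \<Longrightarrow> y + x \<notin> T" for T x y
    using subspace_diff[of T "x + y" x] subspace_diff[of T "y + x" x] by auto
  have addG: "x + y \<in> G" if "x \<in> G" "y \<in> G" for x y using that G by (simp add: subspace_add)
  have dM: "degree (weight M G) \<le> Suc (degree (inverse_KL_poly (local.point_matroid (points_in M G))))"
    if "dim G \<le> Suc (dim G')"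
    using degree_weight_le_add[of M G] that by (simp add: G'_def)
  have P: "points_in M G \<subseteq> local.proj_points V" using subset_points points_in_subset[of M G] by auto
  have "degree (weight M G) \<le> ?l + 1 \<and> degree (weight B G) \<le> ?l + 1"
  proof (cases "G \<subseteq> Y")
    case True
    have dec: "\<exists>c. z - c *s g \<in> G \<inter> X" if z: "z \<in> G" for z
    proof -
      obtain c where "z - c *s g \<in> X" using decompose[OF gY, of z] True z by auto
      moreover have "z - c *s g \<in> G" using z g G by (simp add: subspace_diff subspace_scale)
      ultimately show ?thesis by auto
    qed
    have finGX: "fin_subspace (G \<inter> X)" using finG sub by (intro fin_subspace_Int)
    have dimG: "dim G \<le> Suc (dim (G \<inter> X))" by (rule dim_le_Suc[OF finG finGX dec])
    show ?thesis
    proof (cases "G \<inter> X \<subseteq> W")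
      case True
      then have "G \<inter> W \<inter> X = G \<inter> X" by auto
      then show ?thesis
        using degree_weight_le[OF finV subset_points(1) G(1,2)]
          degree_weight_le[OF finV subset_points(2) G(1,2)] dimG by simp
    next
      case False
      have "G \<inter> X - W \<subseteq> G'" using out by auto
      then have "span (G \<inter> X - W) \<subseteq> G'" using sub' by (rule span_minimal)
      then have XG': "G \<inter> X \<subseteq> G'"
        using span_complement[OF _ sub(2) False] G sub by (simp add: subspace_inter)
      have "dim G' < dim G" using dim_strict_mono_fin[OF finG' finG] G'G nG by auto
      \<comment> \<open>\<open>G'\<close> is a proper subspace of \<open>G\<close> containing
        \<open>G \<inter> X\<close>, whose codimension in \<open>G\<close> is at most one.\<close>
      then have eq: "G' = G \<inter> X"
        using subspace_dim_eq_fin[OF finGX finG' XG'] dimG by simp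
      \<comment> \<open>No deleted point lies in \<open>X\<close>, so inside \<open>G'\<close> the
        deletion is invisible and the bound for \<open>B\<close> applies to
        \<open>M\<close>.\<close>
      have "points_in M G = points_in B G'"
      proof (intro equalityI subsetI)
        fix L assume L: "L \<in> points_in M G"
        then have "L \<subseteq> G'"
          unfolding G'_def using point_span_subset_iff[of "local.point_span (points_in M G)" "points_in M G"]
          by auto
        then show "L \<in> points_in B G'" using L by (auto simp: points_in_def M_def)
      next
        fix L assume L: "L \<in> points_in B G'"
        then have "L \<in> local.proj_points X" using eq by (auto simp: points_in_def B_def proj_points_def)
        then show "L \<in> points_in M G" using L S eq by (auto simp: points_in_def M_def)
      qed
      moreover have "local.point_span (points_in B G') = G'"
        using calculation by (simp add: G'_def)
      then have "weight B G' = signed inverse_KL_poly (local.point_matroid (points_in B G'))"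
        by (simp add: weight_def)
      ultimately have "degree (weight M G) \<le> Suc (degree (weight B G'))"
        using dM dimG eq by simp
      also have "degree (weight B G') \<le> dim (G' \<inter> W)"
        unfolding B_def using G'G G by (intro degree_weight_complement[OF finV sub(2) sub']) auto
      finally have "degree (weight M G) \<le> ?l + 1" using eq by (simp add: Int_ac)
      moreover have "degree (weight B G) \<le> ?l + 1"
      proof -
        have "degree (weight B G) \<le> dim (G \<inter> W)"
          unfolding B_def by (rule degree_weight_complement[OF finV sub(2) G(1,2)])
        also have "\<dots> \<le> Suc ?l"
        proof (cases "G \<inter> W \<subseteq> X")
          case True
          then have "G \<inter> W \<inter> X = G \<inter> W" by auto
          then show ?thesis by simp
        next
          case False
          then obtain w where w: "w \<in> G" "w \<in> W" "w \<notin> X" by auto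
          show ?thesis
          proof (rule dim_le_Suc)
            fix x assume x: "x \<in> G \<inter> W"
            then obtain c where "x - c *s w \<in> X" using decompose[of w x] w \<open>G \<subseteq> Y\<close> by auto
            moreover have "x - c *s w \<in> G" "x - c *s w \<in> W"
              using x w G sub by (auto intro!: subspace_diff subspace_scale)
            ultimately show "\<exists>c. x - c *s w \<in> G \<inter> W \<inter> X" by auto
          qed (use finG sub in \<open>auto intro: fin_subspace_Int\<close>)
        qed
        finally show ?thesis by simp
      qed
      ultimately show ?thesis by simp
    qed
  next
    case False
    obtain h where h: "h \<in> G" "h \<notin> W" "h \<notin> Y"
      using subspace_not_subset_Un[OF G(1) sub(2,3) G(3) False] .
    then have hG': "h \<in> G'" using out(1) by blast
    \<comment> \<open>For \<open>k\<close> in \<open>W \<inter> G'\<close> every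
      \<open>g + c *s k\<close> avoids both \<open>W\<close> and \<open>G'\<close>, so it lies in
      \<open>Y - X\<close>. If \<open>k\<close> were not in \<open>X\<close>, some value of
      \<open>c\<close> would move it into the hyperplane \<open>X\<close> of
      \<open>Y\<close>.\<close>
    have WG': "W \<inter> G' \<subseteq> G \<inter> W \<inter> X"
    proof
      fix k assume k: "k \<in> W \<inter> G'"
      have sc: "c *s k \<in> W" "c *s k \<in> G'" "c *s k \<in> G" for c
        using k sub(2) sub' G'G by (auto intro: subspace_scale)
      have gk: "g + c *s k \<in> Y" "g + c *s k \<notin> X" for c
        using out[of "g + c *s k"] addG[OF g(1) sc(3)] add_notin(2)[OF sub(2) sc(1) g(2)]
          add_notin(2)[OF sub' sc(2) g(3)] by blast+
      have kY: "k \<in> Y" using subspace_diff[OF sub(3) gk(1)[of 1] gY(1)] by simp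
      have "k \<in> X"
      proof (rule ccontr)
        assume "k \<notin> X"
        then obtain c where "g - c *s k \<in> X" using decompose[OF kY _ gY(1)] by auto
        then show False using gk(2)[of "- c"] by simp
      qed
      then show "k \<in> G \<inter> W \<inter> X" using k G'G by auto
    qed
    have inW: "x \<in> W" if "x \<in> G" "x \<notin> G'" "x \<notin> Y" for x
      using out(1)[of x] that by blast
    have dimG: "dim G \<le> Suc (dim G')"
    proof (rule dim_le_Suc[OF finG finG', of "g"])
      fix x assume x: "x \<in> G"
      show "\<exists>c. x - c *s g \<in> G'"
      proof (cases "x \<in> G'")
        case True
        then show ?thesis by (intro exI[of _ 0]) simp
      next
        case xG': False
        \<comment> \<open>Otherwise \<open>x\<close> lies in \<open>Y\<close>, so
          \<open>x + h\<close> and \<open>x + g + h\<close> avoid \<open>G'\<close> and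
          \<open>Y\<close>. Both are then in \<open>W\<close>, and so is their difference
          \<open>g\<close>, a contradiction.\<close>
        have "x + g \<in> G'"
        proof (rule ccontr)
          assume xg: "x + g \<notin> G'"
          have "x + g \<in> G" using addG x g by simp
          have "x \<in> Y"
          proof (cases "x \<in> W")
            case True
            then have "x + g \<notin> W" using add_notin(1)[OF sub(2) _ g(2)] by blast
            then have "x + g \<in> Y" using out(1) \<open>x + g \<in> G\<close> xg by blast
            then show ?thesis using subspace_diff[OF sub(3) _ gY(1), of "x + g"] by simp
          qed (use out(1) x xG' in blast)
          have "x + h \<in> W"
            by (rule inW[OF addG[OF x h(1)] add_notin(2)[OF sub' hG' xG']
                add_notin(1)[OF sub(3) \<open>x \<in> Y\<close> h(3)]])
          moreover have "x + g + h \<in> W"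
            by (rule inW[OF addG[OF \<open>x + g \<in> G\<close> h(1)] add_notin(2)[OF sub' hG' xg]
                add_notin(1)[OF sub(3) subspace_add[OF sub(3) \<open>x \<in> Y\<close> gY(1)] h(3)]])
          ultimately have "(x + g + h) - (x + h) \<in> W" by (intro subspace_diff[OF sub(2)])
          then show False using g by simp
        qed
        then show ?thesis by (intro exI[of _ "- 1"]) simp
      qed
    qed
    \<comment> \<open>Here \<open>g + h\<close> avoids \<open>G'\<close> and \<open>Y\<close>, so it
      lies in \<open>W\<close>. For \<open>x\<close> in \<open>G'\<close>, either
      \<open>g + x\<close> is in \<open>W\<close>, giving \<open>x - h\<close> in \<open>W\<close>,
      or \<open>g + x + h\<close> is in \<open>W\<close>, giving \<open>x\<close> in
      \<open>W\<close>.\<close>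
    have "dim G' \<le> Suc (dim (W \<inter> G'))"
    proof (rule dim_le_Suc[OF finG', of _ h])
      show "fin_subspace (W \<inter> G')" using fin sub' by (intro fin_subspace_Int)
      fix x assume x: "x \<in> G'"
      have gx: "g + x \<in> G" "g + x \<notin> G'" "g + h \<in> G" "g + h \<notin> G'"
        using addG g x h hG' G'G add_notin(2)[OF sub'] by auto
      have gh: "g + h \<in> W" using inW[OF gx(3,4)] add_notin(1)[OF sub(3) gY(1) h(3)] by blast
      show "\<exists>c. x - c *s h \<in> W \<inter> G'"
      proof (cases "g + x \<in> W")
        case True
        have "x - h \<in> W" using subspace_diff[OF sub(2) True gh] by simp
        moreover have "x - h \<in> G'" using x hG' sub' by (simp add: subspace_diff)
        ultimately show ?thesis by (intro exI[of _ 1]) simp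
      next
        case False
        then have "g + x \<in> Y" using out(1) gx by blast
        then have "(g + x) + h \<in> W"
          by (intro inW addG[OF gx(1) h(1)] add_notin(2)[OF sub' hG' gx(2)]
              add_notin(1)[OF sub(3) _ h(3)])
        from subspace_diff[OF sub(2) this gh] have "x \<in> W" by simp
        then show ?thesis using x by (intro exI[of _ 0]) simp
      qed
    qed
    also have "dim (W \<inter> G') \<le> ?l"
      using WG' G sub sub' by (intro mono) (auto simp: subspace_inter)
    finally have l: "dim G' \<le> Suc ?l" by simp
    have pos: "dim G' > 0" using dim_pos[OF finG' hG'] h(2) subspace_0[OF sub(2)] by blast
    have "2 * degree (inverse_KL_poly (local.point_matroid (points_in M G))) < dim G'"
      using degree_signed_inverse_KL_point_matroid(2)[OF finV P] pos by (simp add: G'_def)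
    \<comment> \<open>The extra factor costs at most one degree, and the inverse polynomial has
      degree below \<open>(?l + 1) / 2\<close>, hence at most \<open>?l\<close>.\<close>
    then have "degree (weight M G) \<le> ?l + 1" using dM[OF dimG] l by linarith
    moreover have "degree (weight B G) \<le> ?l + 1"
      using degree_weight_complement_spanned[OF finV sub(2) G] dimG l pos unfolding B_def by linarith
    ultimately show ?thesis by simp
  qed
  then show "degree (weight M G) \<le> ?l + 1" "degree (weight B G) \<le> ?l + 1" by simp_all
qed

text \<open>Inside \<open>W\<close> neither set has points, so the weights agree. Where
  \<open>M\<close> fails to span \<open>G\<close>, both weights are bounded separately. Elsewhere
  both have degree below \<open>dim G / 2\<close>, and palindromicity of the difference reduces the
  bound to proper subspaces.\<close>

lemma degree_weight_diff:
  assumes "subspace G" "G \<subseteq> V"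
  shows "degree (weight M G - weight B G) \<le> dim (G \<inter> W \<inter> X) + 1"
  using assms
proof (induction "dim G" arbitrary: G rule: less_induct)
  case less
  have finG: "fin_subspace G" using fin_subspace_subset[OF finV] less.prems by blast
  consider "G \<subseteq> W" | "\<not> G \<subseteq> W" "local.point_span (points_in M G) \<noteq> G"
    | "\<not> G \<subseteq> W" "local.point_span (points_in M G) = G" by blast
  then show ?case
  proof cases
    case 1
    then have "points_in M G = {}" "points_in B G = {}"
      using points_in_complement_eq_empty_iff[OF sub(2), of G V S]
        points_in_complement_eq_empty_iff[OF sub(2), of G V "{}"] by (simp_all add: M_def B_def)
    then show ?thesis by (simp add: weight_no_points)
  next
    case 2
    then show ?thesis using degree_weight_unspanned[OF less.prems] by (intro degree_diff_le)
  next
    case 3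
    obtain g where "g \<in> G" "g \<notin> W" using 3 by auto
    then have pos: "dim G > 0" using dim_pos[OF finG] subspace_0[OF sub(2)] by blast
    let ?f = "\<lambda>G. weight M G - weight B G"
    have "palindromic_sums V ?f"
      by (intro palindromic_sums_diff palindromic_sums_weight finV subset_points)
    then show ?thesis
    proof (rule palindromic_sums_degree_le[OF finV _ less.prems])
      have "degree (?f G) \<le> max (degree (weight M G)) (degree (weight B G))"
        by (rule degree_diff_le_max)
      moreover have "2 * degree (weight M G) < dim G"
        using degree_weight_spanned[OF finV subset_points(2) 3(2) pos] .
      moreover have "2 * degree (weight B G) < dim G"
        using degree_weight_complement_spanned[OF finV sub(2) less.prems 3(1)] by (simp add: B_def)
      ultimately show "2 * degree (?f G) < dim G" by auto
      fix H assume H: "subspace H" "H \<subset> G"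
      then have finH: "fin_subspace H" using fin_subspace_subset[OF finG] by blast
      have "degree (?f H) \<le> dim (H \<inter> W \<inter> X) + 1"
        using H less.prems dim_strict_mono_fin[OF finH finG] by (intro less.hyps) auto
      also have "dim (H \<inter> W \<inter> X) \<le> dim (G \<inter> W \<inter> X)"
        using H finH finG sub by (intro dim_mono_fin fin_subspace_Int) auto
      finally show "degree (?f H) \<le> dim (G \<inter> W \<inter> X) + 1" by simp
    qed
  qed
qed

lemma B_spans: "local.point_span B = V"
proof
  show "local.point_span B \<subseteq> V" using point_span_subset sub subset_points by blast
  show "V \<subseteq> local.point_span B" using M_spans point_span_mono[of M B] by (auto simp: M_def)
qed

text \<open>Both \<open>M\<close> and \<open>B\<close> span \<open>V\<close>, so at \<open>V\<close>
  each weight is the inverse polynomial up to the common sign.\<close>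

lemma inverse_KL_diff_eq:
  "(-1) ^ dim V * local.inverse_KL_diff V W S = weight M V - weight B V"
  using weight_top[OF sub(1) subset_points(1) B_spans] weight_top[OF sub(1) subset_points(2) M_spans]
  by (simp add: inverse_KL_diff_def B_def M_def right_diff_distrib)

lemma degree_inverse_KL_diff:
  "degree (local.inverse_KL_diff V W S) = degree (weight M V - weight B V)"
  unfolding inverse_KL_diff_eq[symmetric] by (cases "even (dim V)") simp_all

lemma degree_inverse_KL_diff_le:
  "degree (local.inverse_KL_diff V W S) \<le> min (dim (W \<inter> X) + 1) ((dim V - 1) div 2)"
proof -
  have "V \<inter> W \<inter> X = W \<inter> X" using incl by auto
  then have "degree (local.inverse_KL_diff V W S) \<le> dim (W \<inter> X) + 1"
    using degree_weight_diff[OF sub(1) order_refl] by (simp add: degree_inverse_KL_diff)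
  moreover have "degree (local.inverse_KL_diff V W S) \<le> (dim V - 1) div 2"
  proof -
    have "dim V > 0" using dim_strict_mono_fin[OF fin(1) finV incl(1)] by simp
    then have "2 * degree (weight M V) < dim V" "2 * degree (weight B V) < dim V"
      using degree_weight_spanned[OF finV subset_points(1), of V]
        degree_weight_spanned[OF finV subset_points(2), of V]
      by (simp_all add: points_in_proj_points sub subset_points M_spans B_spans)
    moreover have "degree (weight M V - weight B V) \<le> max (degree (weight M V)) (degree (weight B V))"
      by (rule degree_diff_le_max)
    ultimately show ?thesis by (simp add: degree_inverse_KL_diff)
  qed
  ultimately show ?thesis by simp
qed

end

section \<open>Sharpness\<close>

lemma finite_field_space_seq_scale:
  "finite_field_space (seq_scale :: 'f::{field,finite} \<Rightarrow> _)"
  by (simp add: finite_field_space_def vector_space_seq_scale)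

text \<open>A nested copy of the coordinate space of dimension \<open>n\<close> in the space of
  sequences.\<close>

definition initial_seqs :: "nat \<Rightarrow> (nat \<Rightarrow> 'f::{field,finite}) set" where
  "initial_seqs n = {v. \<forall>i\<ge>n. v i = 0}"

lemma initial_seqs_mono: "m \<le> n \<Longrightarrow> initial_seqs m \<subseteq> initial_seqs n"
  by (auto simp: initial_seqs_def)

interpretation seq: finite_field_space "seq_scale :: 'f::{field,finite} \<Rightarrow> _"
  by (rule finite_field_space_seq_scale)

lemma subspace_initial_seqs: "seq.subspace (initial_seqs n)"
  by (auto simp: seq.subspace_def initial_seqs_def seq_scale_def)

lemma initial_seqs_Suc:
  "(initial_seqs (Suc n) :: (nat \<Rightarrow> 'f::{field,finite}) set) =
    seq.span (insert (\<lambda>i. if i = n then 1 else 0) (initial_seqs n))"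
proof -
  let ?e = "\<lambda>i. if i = n then 1 else 0 :: 'f"
  have "v \<in> initial_seqs (Suc n)" if "v - seq_scale k ?e \<in> initial_seqs n" for v k
  proof -
    have "v i = 0" if "i \<ge> Suc n" for i
      using \<open>v - seq_scale k ?e \<in> initial_seqs n\<close> that
      by (auto simp: initial_seqs_def seq_scale_def dest!: spec[of _ i])
    then show ?thesis by (simp add: initial_seqs_def)
  qed
  moreover have "v - seq_scale (v n) ?e \<in> initial_seqs n" if "v \<in> initial_seqs (Suc n)" for v
    unfolding initial_seqs_def
  proof (intro CollectI allI impI)
    fix i assume "n \<le> i"
    then show "(v - seq_scale (v n) ?e) i = 0"
      using that by (cases "i = n") (auto simp: initial_seqs_def seq_scale_def)
  qed
  moreover have span: "seq.span (initial_seqs n) = (initial_seqs n :: (nat \<Rightarrow> 'f) set)"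
    by (simp add: subspace_initial_seqs)
  ultimately show ?thesis unfolding seq.span_insert span by blast
qed

lemma dim_initial_seqs:
  "seq.fin_subspace (initial_seqs n :: (nat \<Rightarrow> 'f::{field,finite}) set) \<and> seq.dim (initial_seqs n :: (nat \<Rightarrow> 'f) set) = n"
proof (induction n)
  case 0
  have "initial_seqs 0 = {0 :: nat \<Rightarrow> 'f}" by (auto simp: initial_seqs_def)
  then show ?case
    using seq.fin_subspace_span[of "{} :: (nat \<Rightarrow> 'f) set"] seq.dim_span_eq_card_independent[of "{} :: (nat \<Rightarrow> 'f) set"] by simp
next
  case (Suc n)
  have "(\<lambda>i. if i = n then 1 else 0 :: 'f) \<notin> initial_seqs n" by (auto simp: initial_seqs_def)
  with Suc show ?case
    by (simp add: initial_seqs_Suc seq.fin_subspace_span_insert seq.dim_span_insert_fin del: seq.dim_span)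
qed

text \<open>Here \<open>W = X\<close>, and deleting all points of \<open>Y\<close> outside
  \<open>X\<close> leaves the complement of \<open>Y\<close>. The dimension \<open>2 * l + 3\<close>
  is \<open>2 * dim Y + 1\<close>, as the coefficient computation for a complement requires.\<close>

lemma sharp_example:
  fixes l :: nat
  defines "V \<equiv> initial_seqs (2 * l + 3) :: (nat \<Rightarrow> 'f::{field,finite}) set"
    and "X \<equiv> initial_seqs l" and "Y \<equiv> initial_seqs (l + 1)"
  defines "S \<equiv> seq.proj_points Y - seq.proj_points X"
  shows "seq.deletion_setup V X Y X S" "seq.dim X = l" "degree (seq.inverse_KL_diff V X S) = l + 1"
proof -
  have fin: "seq.fin_subspace V" "seq.fin_subspace X" "seq.fin_subspace Y"
    and dims: "seq.dim V = 2 * l + 3" "seq.dim X = l" "seq.dim Y = l + 1"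
    by (simp_all add: V_def X_def Y_def dim_initial_seqs del: One_nat_def)
  note sub = fin[THEN seq.fin_subspaceD(1)]
  have incl: "X \<subseteq> Y" "Y \<subseteq> V" by (simp_all add: V_def X_def Y_def initial_seqs_mono)
  have "seq.dim V \<noteq> seq.dim X" "seq.dim V \<noteq> seq.dim Y" unfolding dims by simp_all
  then have "V \<noteq> X" "V \<noteq> Y" by blast+
  then have ne: "X \<noteq> V" "\<not> V \<subseteq> Y" using incl by blast+
  have M: "seq.proj_points V - seq.proj_points X - S = seq.proj_points V - seq.proj_points Y"
    using seq.proj_points_mono[OF incl(1)] by (auto simp: S_def)
  have "seq.point_span (seq.proj_points V - seq.proj_points Y) = V"
    using seq.point_span_complement[OF sub(1,3,1) order_refl ne(2)]
    by (simp add: seq.points_in_proj_points sub)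
  moreover have "seq.fin_dim_subspace V"
    unfolding seq.fin_dim_subspace_def using fin(1) by (auto simp: seq.fin_subspaceD intro!: exI[of _ V])
  ultimately show del: "seq.deletion_setup V X Y X S"
    unfolding seq.deletion_setup_def M using sub incl ne dims by (auto simp: S_def)
  show "seq.dim X = l" by (fact dims)
  interpret D: deletion seq_scale V X Y X S by unfold_locales (rule del)
  \<comment> \<open>This coefficient cannot be cancelled by \<open>B\<close>, the complement of
    \<open>X\<close>, whose weight at \<open>V\<close> has degree at most
    \<open>dim X = l\<close>.\<close>
  have "coeff (seq.weight D.M V) (l + 1) = -1"
    using seq.coeff_weight_complement[OF fin(1) sub(3) incl(2)] dims by (simp add: D.M_def D.B_def M)
  moreover have "degree (seq.weight D.B V) \<le> l"
    using seq.degree_weight_complement[OF fin(1) sub(2,1)] incl dims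
    by (simp add: D.B_def Int_absorb1 subset_trans)
  then have "coeff (seq.weight D.B V) (l + 1) = 0" by (intro coeff_eq_0) simp
  ultimately have "coeff (seq.weight D.M V - seq.weight D.B V) (l + 1) \<noteq> 0" by simp
  then have "l + 1 \<le> degree (seq.inverse_KL_diff V X S)"
    unfolding D.degree_inverse_KL_diff by (rule le_degree)
  then show "degree (seq.inverse_KL_diff V X S) = l + 1"
    using D.degree_inverse_KL_diff_le dims by simp
qed

theorem theoremA:
  fixes scale :: "'f::{field,finite} \<Rightarrow> 'v::ab_group_add \<Rightarrow> 'v"
  assumes "vector_space scale"
  shows
    "(\<forall>V W Y X S. vector_space.deletion_setup scale V W Y X S \<longrightarrow>
        degree (vector_space.inverse_KL_diff scale V W S)
          \<le> min (vector_space.dim scale (W \<inter> X) + 1) ((vector_space.dim scale V - 1) div 2))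
     \<and>
     (\<forall>l. \<exists>(V :: (nat \<Rightarrow> 'f) set) W Y X S.
        vector_space.deletion_setup seq_scale V W Y X S \<and>
        vector_space.dim seq_scale (W \<inter> X) = l \<and>
        degree (vector_space.inverse_KL_diff seq_scale V W S) = l + 1)"
proof (intro conjI allI impI)
  fix V W Y X S
  assume "vector_space.deletion_setup scale V W Y X S"
  with assms interpret deletion scale V W Y X S
    by (simp add: deletion_def deletion_axioms_def finite_field_space_def)
  show "degree (vector_space.inverse_KL_diff scale V W S)
      \<le> min (vector_space.dim scale (W \<inter> X) + 1) ((vector_space.dim scale V - 1) div 2)"
    by (rule degree_inverse_KL_diff_le)
next
  fix l
  show "\<exists>(V :: (nat \<Rightarrow> 'f) set) W Y X S.
        vector_space.deletion_setup seq_scale V W Y X S \<and>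
        vector_space.dim seq_scale (W \<inter> X) = l \<and>
        degree (vector_space.inverse_KL_diff seq_scale V W S) = l + 1"
    \<comment> \<open>The example has \<open>W = X\<close>, so \<open>W \<inter> X\<close> collapses
      to \<open>X\<close>.\<close>
    using sharp_example[of l, where 'f = 'f] by (metis Int_absorb)
qed

end
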